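(* For all $\theta\in(0,\infty)$ and all $k\ge1$, $$\beta_{2k}^{(\theta)}\ \ge\ \beta_{2k}^{(1/2)}=\beta_{2k}^{(Hankel)}.$$
   Context: For $\theta\in(0,\infty)$ and $n$ large enough that $\lfloor n/\theta\rfloor\ge1$, let $L_\theta(i,j)=(i+j)\bmod\lfloor n/\theta\rfloor$ for $1\le i,j\le n$, and $A_n^\theta=n^{-1/2}((x_{L_\theta(i,j)}))_{1\le i,j\le n}$, where the real random variables $\{x_i\}_{i\ge0}$ satisfy one of: (1) independent, uniformly bounded, mean $0$, variance $1$; (2) i.i.d. with mean $0$ and variance $1$; (3) independent with mean $0$, variance $1$ and uniformly bounded moments of all orders. Let $F_\theta$ be the limiting spectral distribution (LSD) of $A_n^\theta$, i.e. the non-random distribution function to which, almost surely, the empirical spectral distribution of $A_n^\theta$ converges weakly; it exists and does not depend on the choice of such input sequence. Set $\beta_h^{(\theta)}=\int x^h\,dF_\theta(x)$. $\beta_{2k}^{(Hankel)}$ denotes the $2k$-th moment of the LSD of the symmetric Hankel matrices $H_n=n^{-1/2}((x_{i+j}))_{1\le i,j\le n}$. The moments satisfy $\beta_{2k}^{(\theta)}=\sum_w p_\theta(w)$, the sum being over pair-matched words $w$ of length $2k$ (sequences of $2k$ letters, first occurrences in alphabetical order, each letter appearing exactly twice), where $p_\theta(w)=\lim_n n^{-(k+1)}\#\Pi^*_\theta(w)$ exists and $\Pi^*_\theta(w)$ is the set of $\pi:\{0,\dots,2k\}\to\{1,\dots,n\}$ with $\pi(0)=\pi(2k)$ such that $w[i]=w[j]$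 implies $L_\theta(\pi(i-1),\pi(i))=L_\theta(\pi(j-1),\pi(j))$. *)

theory Defs
  imports
    "HOL-Probability.Probability"
    "Jordan_Normal_Form.Char_Poly"
begin

text \<open>
  Since the Bochner integral of a non-integrable function is 0, the condition
  that the variance equals 1 forces a finite second moment.
\<close>

definition standardized :: "'a measure \<Rightarrow> (nat \<Rightarrow> 'a \<Rightarrow> real) \<Rightarrow> bool" where
  "standardized M x \<longleftrightarrow>
     (\<forall>i. prob_space.expectation M (x i) = 0 \<and> prob_space.variance M (x i) = 1)"

definition uniformly_bounded :: "'a measure \<Rightarrow> (nat \<Rightarrow> 'a \<Rightarrow> real) \<Rightarrow> bool" where
  "uniformly_bounded M x \<longleftrightarrow> (\<exists>B. \<forall>i. AE \<omega> in M. \<bar>x i \<omega>\<bar> \<le> B)"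

definition identically_distributed :: "'a measure \<Rightarrow> (nat \<Rightarrow> 'a \<Rightarrow> real) \<Rightarrow> bool" where
  "identically_distributed M x \<longleftrightarrow> (\<forall>i j. distr M borel (x i) = distr M borel (x j))"

definition uniformly_bounded_moments :: "'a measure \<Rightarrow> (nat \<Rightarrow> 'a \<Rightarrow> real) \<Rightarrow> bool" where
  "uniformly_bounded_moments M x \<longleftrightarrow>
     (\<forall>h::nat. \<exists>C. \<forall>i. integrable M (\<lambda>\<omega>. \<bar>x i \<omega>\<bar> ^ h) \<and>
                     prob_space.expectation M (\<lambda>\<omega>. \<bar>x i \<omega>\<bar> ^ h) \<le> C)"

text \<open>Measurability of the variables is part of \<open>prob_space.indep_vars\<close>.\<close>

definition input_sequence :: "'a measure \<Rightarrow> (nat \<Rightarrow> 'a \<Rightarrow> real) \<Rightarrow> bool" where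
  "input_sequence M x \<longleftrightarrow>
     prob_space M \<and>
     prob_space.indep_vars M (\<lambda>_. borel) x UNIV \<and>
     standardized M x \<and>
     (uniformly_bounded M x \<or> identically_distributed M x \<or> uniformly_bounded_moments M x)"

definition link :: "real \<Rightarrow> nat \<Rightarrow> nat \<Rightarrow> nat \<Rightarrow> nat" where
  "link \<theta> n i j = (i + j) mod nat \<lfloor>real n / \<theta>\<rfloor>"

text \<open>
  Matrix entries are indexed from 0, whence the successors. The finitely many \<open>n\<close>
  with \<open>\<lfloor>n / \<theta>\<rfloor> = 0\<close> do not matter for the limits below.
\<close>

definition theta_matrix :: "(nat \<Rightarrow> 'a \<Rightarrow> real) \<Rightarrow> real \<Rightarrow> nat \<Rightarrow> 'a \<Rightarrow> real mat" where
  "theta_matrix x \<theta> n \<omega> =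
     Matrix.mat n n (\<lambda>(i, j). x (link \<theta> n (Suc i) (Suc j)) \<omega> / sqrt (real n))"

definition hankel_matrix :: "(nat \<Rightarrow> 'a \<Rightarrow> real) \<Rightarrow> nat \<Rightarrow> 'a \<Rightarrow> real mat" where
  "hankel_matrix x n \<omega> =
     Matrix.mat n n (\<lambda>(i, j). x (Suc i + Suc j) \<omega> / sqrt (real n))"

text \<open>
  The empirical spectral distribution function, eigenvalues being counted with multiplicity.
  It is applied to symmetric matrices only, all of whose eigenvalues are real.
\<close>

definition esd :: "real mat \<Rightarrow> real \<Rightarrow> real" where
  "esd A t = real (size (filter_mset (\<lambda>a. a \<le> t) (proots (char_poly A)))) / real (dim_row A)"

text \<open>\<open>F\<close> is given as a Borel probability measure, with distribution function \<open>cdf F\<close>.\<close>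

definition is_lsd :: "'a measure \<Rightarrow> (nat \<Rightarrow> 'a \<Rightarrow> real mat) \<Rightarrow> real measure \<Rightarrow> bool" where
  "is_lsd M A F \<longleftrightarrow>
     real_distribution F \<and> (AE \<omega> in M. weak_conv (\<lambda>n. esd (A n \<omega>)) (cdf F))"

definition moment :: "real measure \<Rightarrow> nat \<Rightarrow> real" where
  "moment F h = (\<integral>x. x ^ h \<partial>F)"

end

theory Submission
  imports Defs "Jordan_Normal_Form.Schur_Decomposition"
begin

text \<open>
  The moment method, applied to the expected empirical spectral distribution. The expected trace of
  the power \<open>2 k\<close> is a sum over closed walks \<open>\<pi>\<close> of \<open>E \<Prod> x\<^bsub>L(\<pi>(i-1), \<pi>(i))\<^esub>\<close>. Walks on which
  some letter occurs exactly once contribute 0, those on which every letter occurs exactly twice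
  contribute 1, and all others have at most \<open>k - 1\<close> letters, hence are only \<open>O(n\<^sup>k)\<close> in number. So
  the moment of order \<open>2 k\<close> is the limit of \<open>n\<^bsup>-(k+1)\<^esup>\<close> times the number of closed walks on which all
  letters have even multiplicity. Counting even multiplicities instead of pair matchings changes
  nothing in the limit, but makes the comparison immediate for every \<open>n\<close>: reducing \<open>i + j\<close> modulo
  anything preserves evenness, and reducing modulo \<open>2 n\<close> (the case \<open>\<theta> = 1/2\<close>) is injective on \<open>{2..2 n}\<close>.

  Inputs with only two moments are replaced by bounded ones at small cost in \<open>L\<^sup>2\<close>; by the
  Hoffman--Wielandt coupling this hardly changes the average of a Lipschitz function over the
  spectrum. Bounded moments of order \<open>4 k\<close> give the uniform integrability needed to pass from weak
  convergence to convergence of moments.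
\<close>

section \<open>Diagonalization of real symmetric matrices\<close>

unbundle no vec_syntax
no_notation inner (infix "\<bullet>" 70)

text \<open>Over the complex numbers an eigenvalue \<open>z\<close> exists. For an eigenvector
  \<open>v\<close> the Hermitian form \<open>q\<close> of \<open>A\<close> at \<open>v\<close>
  equals \<open>z\<close> times the squared norm \<open>s\<close>, and \<open>q\<close> is its own
  conjugate because \<open>A\<close> is real and symmetric. So \<open>z\<close> is real, hence a
  root of the characteristic polynomial of \<open>A\<close> itself.\<close>

lemma symmetric_mat_eigenvalue:
  fixes A :: "real mat"
  assumes A: "A \<in> carrier_mat n n" and sym: "transpose_mat A = A" and n: "n \<noteq> 0"
  shows "\<exists>e. eigenvalue A e"
proof -
  define B where "B = map_mat complex_of_real A"
  have B: "B \<in> carrier_mat n n" using A by (simp add: B_def)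
  have symA: "A $$ (i,j) = A $$ (j,i)" if "i < n" "j < n" for i j
    using sym A that by (metis carrier_matD index_transpose_mat(1))
  from char_poly_factorized[OF B] obtain as
    where as: "char_poly B = (\<Prod>a\<leftarrow>as. [:- a, 1:])" "length as = n" by blast
  with n obtain z as' where "as = z # as'" by (cases as) auto
  hence root: "poly (char_poly B) z = 0" using as by simp
  hence "eigenvalue B z" by (simp add: eigenvalue_root_char_poly[OF B])
  then obtain v where v: "v \<in> carrier_vec n" "v \<noteq> 0\<^sub>v n" "B *\<^sub>v v = z \<cdot>\<^sub>v v"
    using B unfolding eigenvalue_def eigenvector_def by auto
  define s where "s = (\<Sum>i<n. (cmod (v $ i))\<^sup>2)"
  define q where "q = (\<Sum>i<n. \<Sum>j<n. cnj (v $ i) * complex_of_real (A $$ (i,j)) * v $ j)"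
  have ev: "z * v $ i = (\<Sum>j<n. complex_of_real (A $$ (i,j)) * v $ j)" if "i < n" for i
  proof -
    have "(B *\<^sub>v v) $ i = (\<Sum>j<n. complex_of_real (A $$ (i,j)) * v $ j)"
      using v(1) that A by (simp add: B_def scalar_prod_def atLeast0LessThan)
    moreover have "(z \<cdot>\<^sub>v v) $ i = z * v $ i" using v(1) that by simp
    ultimately show ?thesis by (simp add: v(3))
  qed
  have "z * of_real s = (\<Sum>i<n. cnj (v $ i) * (z * v $ i))"
    unfolding s_def of_real_sum sum_distrib_left
    by (intro sum.cong refl) (simp add: complex_norm_square mult_ac del: of_real_power)
  also have "\<dots> = q"
    unfolding q_def by (intro sum.cong refl) (simp add: ev sum_distrib_left mult_ac)
  finally have zs: "z * of_real s = q" .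
  have "cnj q = (\<Sum>i<n. \<Sum>j<n. v $ i * complex_of_real (A $$ (i,j)) * cnj (v $ j))"
    by (simp add: q_def)
  also have "\<dots> = (\<Sum>j<n. \<Sum>i<n. v $ i * complex_of_real (A $$ (i,j)) * cnj (v $ j))"
    by (rule sum.swap)
  also have "\<dots> = q"
    unfolding q_def by (intro sum.cong refl) (auto simp: symA mult_ac)
  finally have "cnj z * of_real s = z * of_real s" using zs
    by (metis complex_cnj_complex_of_real complex_cnj_mult)
  moreover have "s \<noteq> 0"
  proof
    assume "s = 0"
    hence "\<forall>i<n. v $ i = 0" unfolding s_def by (subst (asm) sum_nonneg_eq_0_iff) auto
    hence "v = 0\<^sub>v n" using v(1) by (intro eq_vecI) auto
    with v(2) show False by simp
  qed
  ultimately have "cnj z = z" by simp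
  then obtain r where z: "z = of_real r" by (metis Reals_cases Reals_cnj_iff)
  have "poly (char_poly A) r = 0"
    using root unfolding B_def of_real_hom.char_poly_hom[OF A] z by simp
  thus ?thesis using eigenvalue_root_char_poly[OF A] by blast
qed

definition diagonal :: "nat \<Rightarrow> (nat \<Rightarrow> real) \<Rightarrow> real mat" where
  "diagonal n d = mat n n (\<lambda>(i, j). if i = j then d i else 0)"

lemma diagonal_carrier [simp]: "diagonal n d \<in> carrier_mat n n"
  by (simp add: diagonal_def)

text \<open>Gram-Schmidt applied to a basis that starts with \<open>v\<close> keeps \<open>v\<close>
  in first place; normalizing its output gives the columns of \<open>W\<close>. With an eigenvector
  for \<open>v\<close>, this is the change of basis that splits off one eigenvalue.\<close>

lemma orthonormal_completion:
  fixes v :: "real vec"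
  assumes v: "v \<in> carrier_vec n" and v0: "v \<noteq> 0\<^sub>v n"
  shows "\<exists>W c. W \<in> carrier_mat n n \<and> transpose_mat W * W = 1\<^sub>m n \<and> col W 0 = c \<cdot>\<^sub>v v"
proof -
  interpret cof_vec_space n "TYPE(real)" .
  note b = basis_completion[OF v v0]
  define ws where "ws = gram_schmidt n (basis_completion v)"
  note gs = gram_schmidt_result[OF b(2,4,5) refl, folded ws_def]
  have ws: "set ws \<subseteq> carrier_vec n" "corthogonal ws" "length ws = n" using gs b by auto
  have n: "n \<noteq> 0" using v v0 by (metis carrier_vecD eq_vecI index_zero_vec(2) not_less_zero)
  obtain vs where "basis_completion v = v # vs" using b(6,7) n by (cases "basis_completion v") auto
  hence hd: "ws ! 0 = v"
    using gram_schmidt_hd[OF v, of vs] ws(3) n by (metis hd_conv_nth length_0_conv ws_def)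
  define W where "W = mat_of_cols n (map (\<lambda>w. (1 / sqrt (w \<bullet> w)) \<cdot>\<^sub>v w) ws)"
  have wsc: "ws ! i \<in> carrier_vec n" if "i < n" for i using that ws by auto
  have W: "W \<in> carrier_mat n n" using ws by (auto simp: W_def mat_of_cols_def)
  have colW: "col W i = (1 / sqrt (ws ! i \<bullet> ws ! i)) \<cdot>\<^sub>v (ws ! i)" if "i < n" for i
    using that ws wsc[OF that] unfolding W_def by (subst col_mat_of_cols) auto
  have conj: "conjugate w = w" for w :: "real vec" by (rule eq_vecI) auto
  have orth: "ws ! i \<bullet> ws ! j = 0 \<longleftrightarrow> i \<noteq> j" if "i < n" "j < n" for i j
    using corthogonalD[OF ws(2), of i j] that ws(3) by (simp add: conj)
  have nonneg: "ws ! i \<bullet> ws ! i \<ge> 0" for i by (simp add: scalar_prod_def sum_nonneg)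
  have "transpose_mat W * W = 1\<^sub>m n"
  proof (rule eq_matI)
    fix i j assume ij: "i < dim_row (1\<^sub>m n :: real mat)" "j < dim_col (1\<^sub>m n :: real mat)"
    hence ij: "i < n" "j < n" by auto
    have "(transpose_mat W * W) $$ (i,j) = col W i \<bullet> col W j" using W ij by simp
    also have "\<dots> = (ws ! i \<bullet> ws ! j) / (sqrt (ws ! i \<bullet> ws ! i) * sqrt (ws ! j \<bullet> ws ! j))"
      unfolding colW[OF ij(1)] colW[OF ij(2)] using wsc[OF ij(1)] wsc[OF ij(2)]
      by simp
    also have "\<dots> = (1\<^sub>m n) $$ (i,j)"
      using orth[OF ij] nonneg[of i] ij by (auto simp: real_sqrt_mult[symmetric])
    finally show "(transpose_mat W * W) $$ (i,j) = (1\<^sub>m n) $$ (i,j)" .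
  qed (use W in auto)
  moreover have "col W 0 = (1 / sqrt (v \<bullet> v)) \<cdot>\<^sub>v v" using colW[of 0] n hd by simp
  ultimately show ?thesis using W by blast
qed

lemma mult_block_diagonal:
  fixes A A' D D' :: "real mat"
  assumes "A \<in> carrier_mat m m" "A' \<in> carrier_mat m m" "D \<in> carrier_mat n n" "D' \<in> carrier_mat n n"
  shows "four_block_mat A (0\<^sub>m m n) (0\<^sub>m n m) D * four_block_mat A' (0\<^sub>m m n) (0\<^sub>m n m) D'
       = four_block_mat (A * A') (0\<^sub>m m n) (0\<^sub>m n m) (D * D')"
proof -
  have "A * 0\<^sub>m m n + 0\<^sub>m m n * D' = 0\<^sub>m m n" "0\<^sub>m n m * A' + D * 0\<^sub>m n m = 0\<^sub>m n m"
    "A * A' + 0\<^sub>m m n * 0\<^sub>m n m = A * A'" "0\<^sub>m n m * 0\<^sub>m m n + D * D' = D * D'"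
    using assms by auto
  thus ?thesis
    using assms by (subst mult_four_block_mat[of _ m m _ n _ n _ _ m _ n]) auto
qed

text \<open>Deflation: in an orthonormal basis whose first member is an eigenvector, the first
  column is zero below the corner, and by symmetry the first row is zero beyond it. The remaining
  block is symmetric and smaller.\<close>

theorem real_spectral_theorem:
  fixes A :: "real mat"
  assumes "A \<in> carrier_mat n n" and "transpose_mat A = A"
  shows "\<exists>U d. U \<in> carrier_mat n n \<and> transpose_mat U * U = 1\<^sub>m n \<and>
               A = U * diagonal n d * transpose_mat U"
  using assms
proof (induction n arbitrary: A)
  case 0
  show ?case by (rule exI[of _ "1\<^sub>m 0"]) (use 0 in \<open>auto intro!: eq_matI simp: diagonal_def\<close>)
next
  case (Suc n A)
  note A = Suc.prems(1) and sym = Suc.prems(2)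
  from symmetric_mat_eigenvalue[OF A sym] obtain e v where
    v: "v \<in> carrier_vec (Suc n)" "v \<noteq> 0\<^sub>v (Suc n)" "A *\<^sub>v v = e \<cdot>\<^sub>v v"
    using A unfolding eigenvalue_def eigenvector_def by auto
  from orthonormal_completion[OF v(1,2)] obtain W c where
    W: "W \<in> carrier_mat (Suc n) (Suc n)" and WtW: "transpose_mat W * W = 1\<^sub>m (Suc n)"
    and W0: "col W 0 = c \<cdot>\<^sub>v v" by blast
  have Wt: "transpose_mat W \<in> carrier_mat (Suc n) (Suc n)" using W by simp
  have WWt: "W * transpose_mat W = 1\<^sub>m (Suc n)" by (rule mat_mult_left_right_inverse[OF Wt W WtW])
  define A' where "A' = transpose_mat W * A * W"
  have A': "A' \<in> carrier_mat (Suc n) (Suc n)" using A W by (simp add: A'_def)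
  have sym': "transpose_mat A' = A'"
    unfolding A'_def using A W sym
    by (simp add: transpose_mult[of _ "Suc n" "Suc n" _ "Suc n"] assoc_mult_mat[of _ "Suc n" "Suc n" _ "Suc n" _ "Suc n"])
  have symA': "A' $$ (i,j) = A' $$ (j,i)" if "i < Suc n" "j < Suc n" for i j
    using sym' A' that by (metis carrier_matD index_transpose_mat(1))
  \<comment> \<open>Column 0 of \<open>W\<close> is a multiple of the eigenvector \<open>v\<close>,
    so column 0 of \<open>A'\<close> is \<open>e\<close> times column 0 of
    \<open>transpose_mat W * W\<close>, the identity.\<close>
  have col0: "A' $$ (i,0) = (if i = 0 then e else 0)" if i: "i < Suc n" for i
  proof -
    have AW: "A *\<^sub>v col W 0 = e \<cdot>\<^sub>v col W 0"
      unfolding W0 using v A by (simp add: mult_mat_vec smult_smult_assoc mult.commute)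
    have "A' $$ (i,0) = col W i \<bullet> (A *\<^sub>v col W 0)"
    proof -
      have "A' = transpose_mat W * (A * W)"
        unfolding A'_def using A W by (intro assoc_mult_mat) auto
      moreover have "col (A * W) 0 = A *\<^sub>v col W 0" by (rule col_mult2[OF A W]) simp
      moreover have "(transpose_mat W * (A * W)) $$ (i,0) = row (transpose_mat W) i \<bullet> col (A * W) 0"
        using A W i by (intro index_mult_mat) auto
      ultimately show ?thesis using W i by simp
    qed
    also have "\<dots> = e * (col W i \<bullet> col W 0)"
      unfolding AW using W i by (intro scalar_prod_smult_distrib[of _ "Suc n"]) (simp_all add: carrier_vecI)
    also have "col W i \<bullet> col W 0 = (transpose_mat W * W) $$ (i,0)" using W i by simp
    finally show ?thesis using i by (simp add: WtW)
  qed
  obtain A1 A2 A0 A3 where split: "split_block A' 1 1 = (A1,A2,A0,A3)"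
    by (cases "split_block A' 1 1") auto
  have dims: "dim_row A' = 1 + n" "dim_col A' = 1 + n" using A' by auto
  note blk = split_block[OF split dims]
  have "A1 = mat 1 1 (\<lambda>_. e)" "A0 = 0\<^sub>m n 1" "A2 = 0\<^sub>m 1 n" "A3 = mat n n (\<lambda>(i,j). A' $$ (Suc i, Suc j))"
    using split[unfolded split_block_def Let_def] A' col0
    by (auto intro!: eq_matI simp: symA'[of 0])
  note blocks = this
  have A3: "A3 \<in> carrier_mat n n" and sym3: "transpose_mat A3 = A3"
    using symA' by (auto simp: blocks intro!: eq_matI)
  from Suc.IH[OF A3 sym3] obtain U3 d3 where
    U3: "U3 \<in> carrier_mat n n" "transpose_mat U3 * U3 = 1\<^sub>m n" "A3 = U3 * diagonal n d3 * transpose_mat U3"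
    by blast
  define d where "d = (\<lambda>i. case i of 0 \<Rightarrow> e | Suc j \<Rightarrow> d3 j)"
  \<comment> \<open>The corner 1 leaves the eigenvector already split off untouched;
    \<open>W * V\<close> will be the orthogonal matrix for \<open>A\<close>.\<close>
  define V where "V = four_block_mat (1\<^sub>m 1) (0\<^sub>m 1 n) (0\<^sub>m n 1) U3"
  have V: "V \<in> carrier_mat (Suc n) (Suc n)" using U3 by (auto simp: V_def)
  have Vt: "transpose_mat V = four_block_mat (1\<^sub>m 1) (0\<^sub>m 1 n) (0\<^sub>m n 1) (transpose_mat U3)"
    unfolding V_def using U3 by (subst transpose_four_block_mat[of _ 1 1 _ n _ n]) auto
  have D: "diagonal (Suc n) d = four_block_mat (mat 1 1 (\<lambda>_. e)) (0\<^sub>m 1 n) (0\<^sub>m n 1) (diagonal n d3)"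
    by (rule eq_matI) (auto simp: diagonal_def d_def split: nat.splits)
  have I: "1\<^sub>m (Suc n) = four_block_mat (1\<^sub>m 1) (0\<^sub>m 1 n) (0\<^sub>m n 1) (1\<^sub>m n :: real mat)"
    by (rule eq_matI) auto
  have VtV: "transpose_mat V * V = 1\<^sub>m (Suc n)"
    unfolding Vt unfolding V_def I using U3 by (subst mult_block_diagonal) simp_all
  have "V * diagonal (Suc n) d * transpose_mat V
      = four_block_mat (mat 1 1 (\<lambda>_. e)) (0\<^sub>m 1 n) (0\<^sub>m n 1) (U3 * diagonal n d3 * transpose_mat U3)"
    unfolding Vt unfolding V_def D using U3(1)
    by (subst mult_block_diagonal, simp_all)+
  also have "\<dots> = A'" using blk(5) blocks U3(3) by simp
  finally have A'V: "A' = V * diagonal (Suc n) d * transpose_mat V" ..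
  have "W * A' * transpose_mat W = (W * transpose_mat W) * A * (W * transpose_mat W)"
    unfolding A'_def using A W by (simp add: assoc_mult_mat[of _ "Suc n" "Suc n" _ "Suc n" _ "Suc n"])
  hence AW: "A = W * A' * transpose_mat W" using A by (simp add: WWt)
  show ?case
  proof (intro exI conjI)
    show "W * V \<in> carrier_mat (Suc n) (Suc n)" using W V by simp
    have "transpose_mat (W * V) * (W * V) = transpose_mat V * (transpose_mat W * W) * V"
      using W V by (simp add: transpose_mult[of _ "Suc n" "Suc n" _ "Suc n"] assoc_mult_mat[of _ "Suc n" "Suc n" _ "Suc n" _ "Suc n"])
    thus "transpose_mat (W * V) * (W * V) = 1\<^sub>m (Suc n)" using V by (simp add: WtW VtV)
    show "A = W * V * diagonal (Suc n) d * transpose_mat (W * V)"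
      unfolding AW A'V using W V diagonal_carrier[of "Suc n" d]
      by (simp add: transpose_mult[of _ "Suc n" "Suc n" _ "Suc n"] mult_carrier_mat[of _ "Suc n" "Suc n" _ "Suc n"]
          assoc_mult_mat[of _ "Suc n" "Suc n" _ "Suc n" _ "Suc n"])
  qed
qed

lemma proots_linear_prod_list: "proots (\<Prod>a\<leftarrow>as. [:- a, 1:]) = mset (as :: real list)"
proof (induction as)
  case (Cons a as)
  have "(\<Prod>a\<leftarrow>as. [:- a, 1:]) \<noteq> 0" by (auto simp: prod_list_zero_iff)
  hence "proots (\<Prod>a\<leftarrow>(a # as). [:- a, 1:]) = proots [:- a, 1:] + mset as"
    by (simp add: proots_mult Cons.IH del: mult_pCons_left)
  also have "proots [:- a, 1:] = {#a#}"
    by (rule multiset_eqI) (simp add: order_linear' )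
  finally show ?case by simp
qed simp

text \<open>\<open>A = U D U\<^sup>T\<close> with \<open>U\<close> orthogonal, written with sums instead of matrix products.\<close>

definition diagonalizes :: "nat \<Rightarrow> (nat \<Rightarrow> nat \<Rightarrow> real) \<Rightarrow> (nat \<Rightarrow> real) \<Rightarrow> (nat \<Rightarrow> nat \<Rightarrow> real) \<Rightarrow> bool" where
  "diagonalizes n U d A \<longleftrightarrow>
     (\<forall>i<n. \<forall>j<n. A i j = (\<Sum>k<n. d k * U i k * U j k)) \<and>
     (\<forall>k<n. \<forall>l<n. (\<Sum>i<n. U i k * U i l) = (if k = l then 1 else 0)) \<and>
     (\<forall>i<n. \<forall>j<n. (\<Sum>k<n. U i k * U j k) = (if i = j then 1 else 0))"

lemma diagonalizesD:
  assumes "diagonalizes n U d A"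
  shows "i < n \<Longrightarrow> j < n \<Longrightarrow> A i j = (\<Sum>k<n. d k * U i k * U j k)"
    and "k < n \<Longrightarrow> l < n \<Longrightarrow> (\<Sum>i<n. U i k * U i l) = (if k = l then 1 else 0)"
    and "i < n \<Longrightarrow> j < n \<Longrightarrow> (\<Sum>k<n. U i k * U j k) = (if i = j then 1 else 0)"
  using assms by (simp_all add: diagonalizes_def)

text \<open>Similar matrices share their characteristic polynomial, so the diagonal \<open>d\<close>
  lists the roots with multiplicity. That one \<open>d\<close> serves both claims is what ties the
  spectrum to the entries of \<open>A\<close>.\<close>

corollary symmetric_mat_diagonalization:
  fixes A :: "real mat"
  assumes A: "A \<in> carrier_mat n n" and sym: "\<And>i j. i < n \<Longrightarrow> j < n \<Longrightarrow> A $$ (i,j) = A $$ (j,i)"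
  shows "\<exists>U d. diagonalizes n U d (\<lambda>i j. A $$ (i,j)) \<and>
               proots (char_poly A) = image_mset d (mset_set {..<n})"
proof -
  have "transpose_mat A = A" using A sym by (intro eq_matI) auto
  from real_spectral_theorem[OF A this] obtain U d where
    U: "U \<in> carrier_mat n n" "transpose_mat U * U = 1\<^sub>m n" and AU: "A = U * diagonal n d * transpose_mat U"
    by blast
  have Ut: "transpose_mat U \<in> carrier_mat n n" using U by simp
  have UUt: "U * transpose_mat U = 1\<^sub>m n" by (rule mat_mult_left_right_inverse[OF Ut U])
  let ?D = "diagonal n d"
  have "similar_mat_wit A ?D U (transpose_mat U)"
    by (rule similar_mat_witI[of _ _ n]) (use A U Ut UUt AU in auto)
  hence "char_poly A = char_poly ?D"
    by (intro char_poly_similar) (auto simp: similar_mat_def)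
  also have "\<dots> = (\<Prod>a\<leftarrow>diag_mat ?D. [:- a, 1:])"
    by (rule char_poly_upper_triangular[of _ n]) (auto simp: diagonal_def)
  finally have "proots (char_poly A) = mset (diag_mat ?D)" by (simp add: proots_linear_prod_list)
  also have "diag_mat ?D = map d [0..<n]" by (auto simp: diag_mat_def diagonal_def)
  also have "mset \<dots> = image_mset d (mset_set {..<n})" by (simp add: atLeast0LessThan)
  finally have *: "proots (char_poly A) = image_mset d (mset_set {..<n})" .
  have UD: "(U * ?D) $$ (i,k) = d k * U $$ (i,k)" if "i < n" "k < n" for i k
  proof -
    have "(U * ?D) $$ (i,k) = (\<Sum>l<n. if l = k then U $$ (i,l) * d l else 0)"
      using U(1) that
      by (auto simp: scalar_prod_def diagonal_def atLeast0LessThan if_distrib cong: if_cong)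
    thus ?thesis using that by (simp add: mult.commute)
  qed
  have "A $$ (i,j) = (\<Sum>k<n. d k * U $$ (i,k) * U $$ (j,k))" if "i < n" "j < n" for i j
  proof -
    have "A $$ (i,j) = (\<Sum>k<n. (U * ?D) $$ (i,k) * U $$ (j,k))"
      unfolding AU using U(1) that
      by (subst index_mult_mat) (auto simp: scalar_prod_def atLeast0LessThan diagonal_def)
    thus ?thesis using that by (simp add: UD)
  qed
  moreover have "(\<Sum>k<n. U $$ (i,k) * U $$ (j,k)) = (if i = j then 1 else 0)" if "i < n" "j < n" for i j
  proof -
    have "(\<Sum>k<n. U $$ (i,k) * U $$ (j,k)) = (U * transpose_mat U) $$ (i,j)"
      using U(1) that by (simp add: scalar_prod_def atLeast0LessThan)
    thus ?thesis using that by (simp add: UUt)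
  qed
  moreover have "(\<Sum>k<n. U $$ (k,i) * U $$ (k,j)) = (if i = j then 1 else 0)" if "i < n" "j < n" for i j
  proof -
    have "(\<Sum>k<n. U $$ (k,i) * U $$ (k,j)) = (transpose_mat U * U) $$ (i,j)"
      using U(1) that by (simp add: scalar_prod_def atLeast0LessThan)
    thus ?thesis using that U(2) by simp
  qed
  ultimately have "diagonalizes n (\<lambda>i k. U $$ (i,k)) d (\<lambda>i j. A $$ (i,j))"
    unfolding diagonalizes_def by blast
  with * show ?thesis by blast
qed

section \<open>Traces of powers and Lipschitz spectral statistics\<close>

text \<open>For symmetric \<open>A\<close> this is the trace of \<open>f(A)\<close>.\<close>

definition spectral_sum :: "(real \<Rightarrow> real) \<Rightarrow> real mat \<Rightarrow> real" where
  "spectral_sum f A = (\<Sum>a\<in>#proots (char_poly A). f a)"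

lemma spectral_sum_eq:
  assumes "proots (char_poly A) = image_mset d (mset_set {..<n})"
  shows "spectral_sum f A = (\<Sum>k<n. f (d k))"
  by (simp add: spectral_sum_def assms image_mset.compositionality o_def sum_unfold_sum_mset)

text \<open>\<open>h\<close> counts the steps, so there are \<open>h + 1\<close> vertices; they
  start from 0, like the matrix indices.\<close>

definition walks :: "nat \<Rightarrow> nat \<Rightarrow> nat list set" where
  "walks n h = {p. length p = Suc h \<and> set p \<subseteq> {..<n}}"

definition closed_walks :: "nat \<Rightarrow> nat \<Rightarrow> nat list set" where
  "closed_walks n h = {p \<in> walks n h. hd p = last p}"

fun steps :: "(nat \<Rightarrow> nat \<Rightarrow> 'b) \<Rightarrow> nat list \<Rightarrow> 'b list" where
  "steps f (a # b # p) = f a b # steps f (b # p)"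
| "steps f _ = []"

lemma length_steps: "length (steps f p) = length p - 1"
  by (induction f p rule: steps.induct) auto

lemma finite_walks [simp]: "finite (walks n h)"
  using finite_lists_length_eq[of "{..<n}" "Suc h"] by (simp add: walks_def conj_commute)

lemma finite_closed_walks [simp]: "finite (closed_walks n h)"
  by (simp add: closed_walks_def)

lemma walks_0: "walks n 0 = (\<lambda>a. [a]) ` {..<n}"
  by (auto simp: walks_def length_Suc_conv)

lemma walks_Suc: "walks n (Suc h) = (\<lambda>(a, p). a # p) ` ({..<n} \<times> walks n h)"
  by (auto simp: walks_def length_Suc_conv image_iff)

lemma sum_walks_Suc: "sum F (walks n (Suc h)) = (\<Sum>a<n. \<Sum>p\<in>walks n h. F (a # p))"
proof -
  have "inj_on (\<lambda>(a, p). a # p) ({..<n} \<times> walks n h)" by (auto simp: inj_on_def)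
  thus ?thesis by (simp add: walks_Suc sum.reindex sum.cartesian_product case_prod_unfold)
qed

text \<open>Both sides are the entry \<open>(i, j)\<close> of the \<open>h\<close>-th power of the
  matrix. Free end points, instead of closed walks, permit the induction that removes the first
  vertex.\<close>

lemma sum_walks_spectral:
  assumes AU: "diagonalizes n U d A"
    and ij: "i < n" "j < n"
  shows "(\<Sum>p\<in>walks n h. if hd p = i \<and> last p = j then prod_list (steps A p) else 0)
       = (\<Sum>k<n. d k ^ h * U i k * U j k)"
proof -
  note A = diagonalizesD(1)[OF AU] and orth = diagonalizesD(2)[OF AU] and orth' = diagonalizesD(3)[OF AU]
  show ?thesis
    using ij
  proof (induction h arbitrary: i)
    case 0
    have "(\<Sum>p\<in>walks n 0. if hd p = i \<and> last p = j then prod_list (steps A p) else 0)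
        = (\<Sum>a<n. if a = i then if i = j then 1 else 0 else 0)"
      by (subst walks_0, subst sum.reindex) (auto simp: inj_on_def intro!: sum.cong)
    thus ?case using 0 orth' by simp
  next
    case (Suc h)
    let ?S = "\<lambda>b. \<Sum>p\<in>walks n h. if hd p = b \<and> last p = j then prod_list (steps A p) else 0"
    have "(\<Sum>p\<in>walks n (Suc h). if hd p = i \<and> last p = j then prod_list (steps A p) else 0)
        = (\<Sum>a<n. if a = i then \<Sum>p\<in>walks n h. if last p = j then A i (hd p) * prod_list (steps A p) else 0 else 0)"
      unfolding sum_walks_Suc
    proof (intro sum.cong refl)
      fix a
      have step: "prod_list (steps A (i # p)) = A i (hd p) * prod_list (steps A p)" if "p \<in> walks n h" for p
        using that by (cases p) (auto simp: walks_def)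
      show "(\<Sum>p\<in>walks n h. if hd (a # p) = i \<and> last (a # p) = j then prod_list (steps A (a # p)) else 0)
          = (if a = i then \<Sum>p\<in>walks n h. if last p = j then A i (hd p) * prod_list (steps A p) else 0 else 0)"
      proof (cases "a = i")
        case True
        show ?thesis unfolding True
          by (simp, intro sum.cong refl) (auto simp: step walks_def simp del: steps.simps)
      qed simp
    qed
    also have "\<dots> = (\<Sum>p\<in>walks n h. if last p = j then A i (hd p) * prod_list (steps A p) else 0)"
      using Suc.prems by simp
    also have "\<dots> = (\<Sum>p\<in>walks n h. \<Sum>b<n. if hd p = b \<and> last p = j then A i b * prod_list (steps A p) else 0)"
    proof (intro sum.cong refl)
      fix p assume "p \<in> walks n h"
      hence "hd p < n" by (cases p) (auto simp: walks_def)
      thus "(if last p = j then A i (hd p) * prod_list (steps A p) else 0)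
          = (\<Sum>b<n. if hd p = b \<and> last p = j then A i b * prod_list (steps A p) else 0)"
        by (cases "last p = j") (auto simp: sum.delta')
    qed
    also have "\<dots> = (\<Sum>b<n. A i b * ?S b)"
      by (subst sum.swap, unfold sum_distrib_left, intro sum.cong refl) auto
    also have "\<dots> = (\<Sum>b<n. (\<Sum>k<n. d k * U i k * U b k) * (\<Sum>l<n. d l ^ h * U b l * U j l))"
      using Suc by (intro sum.cong refl) (simp add: A)
    also have "\<dots> = (\<Sum>b<n. \<Sum>k<n. \<Sum>l<n. (d k * U i k * U b k) * (d l ^ h * U b l * U j l))"
      by (simp only: sum_product)
    also have "\<dots> = (\<Sum>k<n. \<Sum>b<n. \<Sum>l<n. (d k * U i k * U b k) * (d l ^ h * U b l * U j l))"
      by (rule sum.swap)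
    also have "\<dots> = (\<Sum>k<n. \<Sum>l<n. \<Sum>b<n. (d k * U i k * U b k) * (d l ^ h * U b l * U j l))"
      by (rule sum.cong[OF refl], rule sum.swap)
    also have "\<dots> = (\<Sum>k<n. \<Sum>l<n. (d k * U i k * d l ^ h * U j l) * (\<Sum>b<n. U b k * U b l))"
      unfolding sum_distrib_left by (intro sum.cong refl) (simp add: mult_ac)
    \<comment> \<open>Orthonormality of the columns of \<open>U\<close> collapses the double sum;
      the base case used orthonormality of the rows instead.\<close>
    also have "\<dots> = (\<Sum>k<n. \<Sum>l<n. if k = l then d k * U i k * d l ^ h * U j l else 0)"
      by (intro sum.cong refl) (simp add: orth)
    also have "\<dots> = (\<Sum>k<n. d k ^ Suc h * U i k * U j k)"
      by (intro sum.cong refl) (simp add: mult_ac)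
    finally show ?case .
  qed
qed

text \<open>The trace of the \<open>h\<close>-th power: the walk expansion with
  \<open>i = j\<close>, summed over \<open>i\<close>. The columns of \<open>U\<close> are unit
  vectors, so only the powers of the eigenvalues remain.\<close>

lemma spectral_sum_power:
  assumes A: "A \<in> carrier_mat n n" and sym: "\<And>i j. i < n \<Longrightarrow> j < n \<Longrightarrow> A $$ (i,j) = A $$ (j,i)"
  shows "spectral_sum (\<lambda>a. a ^ h) A
       = (\<Sum>p\<in>closed_walks n h. prod_list (steps (\<lambda>i j. A $$ (i,j)) p))"
proof -
  from symmetric_mat_diagonalization[OF A sym] obtain U d where
    AU: "diagonalizes n U d (\<lambda>i j. A $$ (i,j))"
    and roots: "proots (char_poly A) = image_mset d (mset_set {..<n})" by blast
  let ?P = "\<lambda>p. prod_list (steps (\<lambda>i j. A $$ (i,j)) p)"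
  have hd: "hd p < n" if "p \<in> walks n h" for p using that by (cases p) (auto simp: walks_def)
  have "(\<Sum>p\<in>closed_walks n h. ?P p) = (\<Sum>p\<in>walks n h. if hd p = last p then ?P p else 0)"
    unfolding closed_walks_def by (rule sum.inter_filter) simp
  also have "\<dots> = (\<Sum>p\<in>walks n h. \<Sum>i<n. if i = hd p then if hd p = i \<and> last p = i then ?P p else 0 else 0)"
    by (intro sum.cong refl) (auto simp: hd)
  also have "\<dots> = (\<Sum>i<n. \<Sum>p\<in>walks n h. if hd p = i \<and> last p = i then ?P p else 0)"
    by (subst sum.swap, intro sum.cong refl) auto
  also have "\<dots> = (\<Sum>i<n. \<Sum>k<n. d k ^ h * U i k * U i k)"
    by (intro sum.cong refl sum_walks_spectral[OF AU]) auto
  also have "\<dots> = (\<Sum>k<n. d k ^ h * (\<Sum>i<n. U i k * U i k))"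
    by (subst sum.swap) (simp add: sum_distrib_left mult_ac)
  also have "\<dots> = (\<Sum>k<n. d k ^ h)" by (simp add: diagonalizesD(2)[OF AU])
  also have "\<dots> = spectral_sum (\<lambda>a. a ^ h) A" by (simp add: spectral_sum_eq[OF roots])
  finally show ?thesis ..
qed

text \<open>The idea of the Hoffman--Wielandt inequality: the squared entries of \<open>U\<^sup>T V\<close> are doubly
  stochastic weights, and they couple the two spectra at quadratic cost \<open>\<parallel>A - B\<parallel>\<^sup>2\<close>.\<close>

lemma spectral_sum_lipschitz:
  assumes A: "A \<in> carrier_mat n n" and symA: "\<And>i j. i < n \<Longrightarrow> j < n \<Longrightarrow> A $$ (i,j) = A $$ (j,i)"
    and B: "B \<in> carrier_mat n n" and symB: "\<And>i j. i < n \<Longrightarrow> j < n \<Longrightarrow> B $$ (i,j) = B $$ (j,i)"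
    and f: "\<And>s t. \<bar>f s - f t\<bar> \<le> L * \<bar>s - t\<bar>" and \<delta>: "\<delta> > 0" and L: "L \<ge> 0"
  shows "\<bar>spectral_sum f A - spectral_sum f B\<bar>
       \<le> L / 2 * (real n * \<delta> + (\<Sum>i<n. \<Sum>j<n. (A $$ (i,j) - B $$ (i,j))\<^sup>2) / \<delta>)"
proof -
  from symmetric_mat_diagonalization[OF A symA] obtain U d where
    dA: "diagonalizes n U d (\<lambda>i j. A $$ (i,j))"
    and rootsA: "proots (char_poly A) = image_mset d (mset_set {..<n})" by blast
  from symmetric_mat_diagonalization[OF B symB] obtain V e where
    dB: "diagonalizes n V e (\<lambda>i j. B $$ (i,j))"
    and rootsB: "proots (char_poly B) = image_mset e (mset_set {..<n})" by blast
  note AU = diagonalizesD(1)[OF dA] and U = diagonalizesD(2)[OF dA] and U' = diagonalizesD(3)[OF dA]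
  note BV = diagonalizesD(1)[OF dB] and V = diagonalizesD(2)[OF dB] and V' = diagonalizesD(3)[OF dB]
  \<comment> \<open>The entrywise inner product of two matrices, expressed by the overlaps of their
    eigenvectors. It is needed for the pairs \<open>(A, A)\<close>, \<open>(B, B)\<close> and
    \<open>(A, B)\<close>.\<close>
  have inner: "(\<Sum>i<n. \<Sum>j<n. A1 i j * A2 i j) = (\<Sum>k<n. \<Sum>l<n. d1 k * d2 l * (\<Sum>i<n. U1 i k * U2 i l)\<^sup>2)"
    if A1: "\<And>i j. i < n \<Longrightarrow> j < n \<Longrightarrow> A1 i j = (\<Sum>k<n. d1 k * U1 i k * U1 j k)"
    and A2: "\<And>i j. i < n \<Longrightarrow> j < n \<Longrightarrow> A2 i j = (\<Sum>k<n. d2 k * U2 i k * U2 j k)"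
    for A1 A2 U1 U2 :: "nat \<Rightarrow> nat \<Rightarrow> real" and d1 d2
  proof -
    have "(\<Sum>i<n. \<Sum>j<n. A1 i j * A2 i j)
        = (\<Sum>i<n. \<Sum>j<n. \<Sum>k<n. \<Sum>l<n. (d1 k * U1 i k * U1 j k) * (d2 l * U2 i l * U2 j l))"
      by (intro sum.cong refl) (simp add: A1 A2 sum_product)
    also have "\<dots> = (\<Sum>i<n. \<Sum>k<n. \<Sum>j<n. \<Sum>l<n. (d1 k * U1 i k * U1 j k) * (d2 l * U2 i l * U2 j l))"
      by (rule sum.cong[OF refl], rule sum.swap)
    also have "\<dots> = (\<Sum>k<n. \<Sum>i<n. \<Sum>l<n. \<Sum>j<n. (d1 k * U1 i k * U1 j k) * (d2 l * U2 i l * U2 j l))"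
      by (rule trans[OF sum.swap], rule sum.cong[OF refl], rule sum.cong[OF refl], rule sum.swap)
    also have "\<dots> = (\<Sum>k<n. \<Sum>l<n. \<Sum>i<n. \<Sum>j<n. (d1 k * U1 i k * U1 j k) * (d2 l * U2 i l * U2 j l))"
      by (rule sum.cong[OF refl], rule sum.swap)
    also have "\<dots> = (\<Sum>k<n. \<Sum>l<n. d1 k * d2 l * (\<Sum>i<n. U1 i k * U2 i l)\<^sup>2)"
      unfolding power2_eq_square sum_product unfolding sum_distrib_left
      by (intro sum.cong refl) (simp add: mult_ac)
    finally show ?thesis .
  qed
  define w where "w = (\<lambda>k l. (\<Sum>i<n. U i k * V i l)\<^sup>2)"
  have w_nonneg: "w k l \<ge> 0" for k l by (simp add: w_def)
  \<comment> \<open>Parseval's identity in an orthonormal basis; it makes all row and column sums of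
    \<open>w\<close> equal to 1.\<close>
  have parseval: "(\<Sum>l<n. (\<Sum>i<n. a i * V1 i l)\<^sup>2) = (\<Sum>i<n. (a i)\<^sup>2)"
    if V1: "\<And>i j. i < n \<Longrightarrow> j < n \<Longrightarrow> (\<Sum>k<n. V1 i k * V1 j k) = (if i = j then 1 else 0)"
    for a :: "nat \<Rightarrow> real" and V1 :: "nat \<Rightarrow> nat \<Rightarrow> real"
  proof -
    have "(\<Sum>l<n. (\<Sum>i<n. a i * V1 i l)\<^sup>2) = (\<Sum>l<n. \<Sum>i<n. \<Sum>j<n. (a i * V1 i l) * (a j * V1 j l))"
      by (simp add: power2_eq_square sum_product)
    also have "\<dots> = (\<Sum>i<n. \<Sum>l<n. \<Sum>j<n. (a i * V1 i l) * (a j * V1 j l))" by (rule sum.swap)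
    also have "\<dots> = (\<Sum>i<n. \<Sum>j<n. \<Sum>l<n. (a i * V1 i l) * (a j * V1 j l))"
      by (rule sum.cong[OF refl], rule sum.swap)
    also have "\<dots> = (\<Sum>i<n. \<Sum>j<n. a i * a j * (\<Sum>l<n. V1 i l * V1 j l))"
      unfolding sum_distrib_left by (intro sum.cong refl) (simp add: mult_ac)
    also have "\<dots> = (\<Sum>i<n. \<Sum>j<n. if i = j then a i * a j else 0)"
      by (intro sum.cong refl) (simp add: V1)
    finally show ?thesis by (simp add: power2_eq_square)
  qed
  have row: "(\<Sum>l<n. w k l) = 1" if "k < n" for k
    using parseval[OF V', of "\<lambda>i. U i k"] U[OF that that] by (simp add: w_def power2_eq_square)
  have col: "(\<Sum>k<n. w k l) = 1" if "l < n" for l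
    using parseval[OF U', of "\<lambda>i. V i l"] V[OF that that] by (simp add: w_def power2_eq_square mult.commute)
  have sA: "spectral_sum g A = (\<Sum>k<n. \<Sum>l<n. w k l * g (d k))" for g
  proof -
    have "spectral_sum g A = (\<Sum>k<n. g (d k) * (\<Sum>l<n. w k l))"
      by (simp add: spectral_sum_eq[OF rootsA] row)
    thus ?thesis by (simp add: sum_distrib_left mult.commute)
  qed
  have sB: "spectral_sum g B = (\<Sum>k<n. \<Sum>l<n. w k l * g (e l))" for g
  proof -
    have "spectral_sum g B = (\<Sum>l<n. g (e l) * (\<Sum>k<n. w k l))"
      by (simp add: spectral_sum_eq[OF rootsB] col)
    also have "\<dots> = (\<Sum>l<n. \<Sum>k<n. w k l * g (e l))" by (simp add: sum_distrib_left mult.commute)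
    finally show ?thesis by (subst sum.swap)
  qed
  have AA: "(\<Sum>i<n. \<Sum>j<n. A $$ (i,j) * A $$ (i,j)) = (\<Sum>k<n. \<Sum>l<n. w k l * (d k)\<^sup>2)"
  proof -
    have "(\<Sum>i<n. \<Sum>j<n. A $$ (i,j) * A $$ (i,j)) = (\<Sum>k<n. \<Sum>l<n. d k * d l * (\<Sum>i<n. U i k * U i l)\<^sup>2)"
      by (rule inner[OF AU AU])
    also have "\<dots> = (\<Sum>k<n. \<Sum>l<n. if k = l then d k * d l else 0)"
      by (intro sum.cong refl) (simp add: U)
    also have "\<dots> = (\<Sum>k<n. (\<Sum>l<n. w k l) * (d k)\<^sup>2)" by (simp add: power2_eq_square row)
    finally show ?thesis by (simp add: sum_distrib_right)
  qed
  have BB: "(\<Sum>i<n. \<Sum>j<n. B $$ (i,j) * B $$ (i,j)) = (\<Sum>k<n. \<Sum>l<n. w k l * (e l)\<^sup>2)"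
  proof -
    have "(\<Sum>i<n. \<Sum>j<n. B $$ (i,j) * B $$ (i,j)) = (\<Sum>k<n. \<Sum>l<n. e k * e l * (\<Sum>i<n. V i k * V i l)\<^sup>2)"
      by (rule inner[OF BV BV])
    also have "\<dots> = (\<Sum>k<n. \<Sum>l<n. if k = l then e k * e l else 0)"
      by (intro sum.cong refl) (simp add: V)
    also have "\<dots> = (\<Sum>l<n. (\<Sum>k<n. w k l) * (e l)\<^sup>2)" by (simp add: power2_eq_square col)
    also have "\<dots> = (\<Sum>l<n. \<Sum>k<n. w k l * (e l)\<^sup>2)" by (simp add: sum_distrib_right)
    finally show ?thesis by (subst sum.swap)
  qed
  have AB: "(\<Sum>i<n. \<Sum>j<n. A $$ (i,j) * B $$ (i,j)) = (\<Sum>k<n. \<Sum>l<n. w k l * (d k * e l))"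
    by (rule trans[OF inner[OF AU BV]]) (simp_all add: w_def mult_ac)
  \<comment> \<open>Expanding the square, the marginals of \<open>w\<close> turn the pure terms into
    the squared norms of \<open>A\<close> and \<open>B\<close>, and the mixed term is their inner
    product. The cost is therefore computed exactly.\<close>
  have cost: "(\<Sum>k<n. \<Sum>l<n. w k l * (d k - e l)\<^sup>2) = (\<Sum>i<n. \<Sum>j<n. (A $$ (i,j) - B $$ (i,j))\<^sup>2)"
  proof -
    have "(\<Sum>k<n. \<Sum>l<n. w k l * (d k - e l)\<^sup>2)
        = (\<Sum>k<n. \<Sum>l<n. w k l * (d k)\<^sup>2 + w k l * (e l)\<^sup>2 - 2 * (w k l * (d k * e l)))"
      by (intro sum.cong refl) (simp add: power2_eq_square algebra_simps)
    also have "\<dots> = (\<Sum>k<n. \<Sum>l<n. w k l * (d k)\<^sup>2) + (\<Sum>k<n. \<Sum>l<n. w k l * (e l)\<^sup>2) - 2 * (\<Sum>k<n. \<Sum>l<n. w k l * (d k * e l))"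
      by (simp add: sum.distrib sum_subtractf sum_distrib_left)
    also have "\<dots> = (\<Sum>i<n. \<Sum>j<n. A $$ (i,j) * A $$ (i,j) + B $$ (i,j) * B $$ (i,j) - 2 * (A $$ (i,j) * B $$ (i,j)))"
      unfolding AA[symmetric] BB[symmetric] AB[symmetric]
      by (simp add: sum.distrib sum_subtractf sum_distrib_left)
    also have "\<dots> = (\<Sum>i<n. \<Sum>j<n. (A $$ (i,j) - B $$ (i,j))\<^sup>2)"
      by (intro sum.cong refl) (simp add: power2_eq_square algebra_simps)
    finally show ?thesis .
  qed
  \<comment> \<open>Used in place of Cauchy-Schwarz: the resulting bound is linear in the quadratic
    cost, so it can be integrated over random inputs, and \<open>\<delta>\<close> stays
    free.\<close>
  have amgm: "t \<le> (\<delta> + t\<^sup>2 / \<delta>) / 2" for t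
  proof -
    have "0 \<le> (\<delta> - t)\<^sup>2" by simp
    hence "2 * t * \<delta> \<le> \<delta> * \<delta> + t\<^sup>2" by (simp add: power2_eq_square algebra_simps)
    thus ?thesis using \<delta> by (simp add: field_simps)
  qed
  have "\<bar>spectral_sum f A - spectral_sum f B\<bar> = \<bar>\<Sum>k<n. \<Sum>l<n. w k l * (f (d k) - f (e l))\<bar>"
    unfolding sA sB by (simp add: sum_subtractf[symmetric] right_diff_distrib)
  also have "\<dots> \<le> (\<Sum>k<n. \<Sum>l<n. w k l * \<bar>f (d k) - f (e l)\<bar>)"
    by (intro order.trans[OF sum_abs] sum_mono order.trans[OF sum_abs]) (simp add: abs_mult w_nonneg)
  also have "\<dots> \<le> (\<Sum>k<n. \<Sum>l<n. w k l * (L * ((\<delta> + (d k - e l)\<^sup>2 / \<delta>) / 2)))"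
  proof (intro sum_mono mult_left_mono w_nonneg)
    fix k l
    have "\<bar>f (d k) - f (e l)\<bar> \<le> L * \<bar>d k - e l\<bar>" by (rule f)
    also have "\<dots> \<le> L * ((\<delta> + (d k - e l)\<^sup>2 / \<delta>) / 2)"
      using amgm[of "\<bar>d k - e l\<bar>"] L by (intro mult_left_mono) auto
    finally show "\<bar>f (d k) - f (e l)\<bar> \<le> \<dots>" .
  qed
  also have "\<dots> = L / 2 * ((\<Sum>k<n. \<Sum>l<n. w k l) * \<delta> + (\<Sum>k<n. \<Sum>l<n. w k l * (d k - e l)\<^sup>2) / \<delta>)"
    unfolding sum_distrib_right sum_divide_distrib sum.distrib[symmetric] sum_distrib_left
    by (intro sum.cong refl) (simp add: field_simps)
  also have "(\<Sum>k<n. \<Sum>l<n. w k l) = real n" by (simp add: row)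
  finally show ?thesis by (simp only: cost)
qed

section \<open>The empirical spectral distribution as a probability measure\<close>

text \<open>The measure is the law of a uniformly chosen eigenvalue. It makes results on weak
  convergence of measures applicable to \<open>esd\<close>.\<close>

lemma esd_eq:
  assumes A: "A \<in> carrier_mat n n" and sym: "\<And>i j. i < n \<Longrightarrow> j < n \<Longrightarrow> A $$ (i,j) = A $$ (j,i)"
    and n: "n > 0"
  shows "\<exists>\<mu>. real_distribution \<mu> \<and> cdf \<mu> = esd A \<and>
             (\<forall>f\<in>borel_measurable borel. integral\<^sup>L \<mu> f = spectral_sum f A / real n)"
proof -
  from symmetric_mat_diagonalization[OF A sym] obtain d :: "nat \<Rightarrow> real" where
    roots: "proots (char_poly A) = image_mset d (mset_set {..<n})" by blast
  let ?p = "pmf_of_set {..<n}"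
  define \<mu> where "\<mu> = distr (measure_pmf ?p) borel d"
  have ne: "{..<n} \<noteq> {}" using n by auto
  have "real_distribution \<mu>"
    unfolding \<mu>_def real_distribution_def real_distribution_axioms_def
    by (auto intro!: prob_space.prob_space_distr simp: measure_pmf.prob_space_axioms)
  moreover have "cdf \<mu> = esd A"
  proof
    fix t
    have "cdf \<mu> t = measure (measure_pmf ?p) (d -` {..t})"
      unfolding cdf_def \<mu>_def by (subst measure_distr) auto
    also have "\<dots> = real (card {i\<in>{..<n}. d i \<le> t}) / real n"
      using ne by (subst measure_pmf_of_set) (auto simp: Int_def conj_commute)
    also have "card {i\<in>{..<n}. d i \<le> t} = size (filter_mset (\<lambda>a. a \<le> t) (proots (char_poly A)))"
      by (simp add: roots filter_mset_image_mset)
    finally show "cdf \<mu> t = esd A t" using A by (simp add: esd_def)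
  qed
  moreover have "integral\<^sup>L \<mu> f = spectral_sum f A / real n" if f: "f \<in> borel_measurable borel" for f
  proof -
    have "integral\<^sup>L \<mu> f = (\<integral>i. f (d i) \<partial>measure_pmf ?p)"
      unfolding \<mu>_def using f by (subst integral_distr) auto
    also have "\<dots> = (\<Sum>i<n. f (d i)) / real n"
      using ne by (subst integral_pmf_of_set) auto
    finally show ?thesis by (simp add: spectral_sum_eq[OF roots])
  qed
  ultimately show ?thesis by blast
qed

section \<open>Counting walks with few letters\<close>

text \<open>Both kinds of matrix depend on \<open>i + j\<close> only, so a link is a function
  \<open>g\<close> of one number. The successors convert vertices to indices that start from 1; the
  argument of \<open>g\<close> thus ranges over \<open>{2..2 * n}\<close>.\<close>

abbreviation "letters g \<equiv> steps (\<lambda>i j. g (Suc i + Suc j) :: nat)"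

definition even_walks :: "(nat \<Rightarrow> nat) \<Rightarrow> nat \<Rightarrow> nat \<Rightarrow> nat list set" where
  "even_walks g n h = {p \<in> closed_walks n h. \<forall>a. even (count_list (letters g p) a)}"

text \<open>A vertex and the letter of an adjacent step leave at most \<open>\<Delta>\<close>
  choices for the neighbouring vertex.\<close>

definition fibre_bound :: "nat \<Rightarrow> (nat \<Rightarrow> nat) \<Rightarrow> nat \<Rightarrow> bool" where
  "fibre_bound \<Delta> g n \<longleftrightarrow> (\<forall>i a. card {j. j < n \<and> g (Suc j + Suc i) = a} \<le> \<Delta>)"

lemma letters_Cons: "p \<noteq> [] \<Longrightarrow> letters g (a # p) = g (Suc a + Suc (hd p)) # letters g p"
  by (cases p) auto

text \<open>A walk is built from its last vertex, which has \<open>n\<close> choices, by prepending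
  vertices. A vertex that creates a new letter has \<open>n\<close> choices, and this happens at
  most \<open>r\<close> times. Any other vertex must reuse one of at most \<open>h\<close> letters,
  which leaves at most \<open>h * \<Delta>\<close> choices.\<close>

lemma card_few_letters:
  assumes fib: "fibre_bound \<Delta> g n"
  shows "card {p \<in> walks n h. card (set (letters g p)) \<le> r} \<le> n ^ Suc r * (1 + h * \<Delta>) ^ h"
proof (cases "n = 0")
  case True
  hence "walks n h = {}" by (auto simp: walks_def)
  thus ?thesis by simp
next
  case False
  let ?X = "\<lambda>h r. {p \<in> walks n h. card (set (letters g p)) \<le> r}"
  have fin: "finite (?X h r)" for h r by (rule finite_subset[OF _ finite_walks[of n h]]) auto
  show ?thesis
  proof (induction h arbitrary: r)
    case 0
    have "card (?X 0 r) \<le> card (walks n 0)" by (intro card_mono) auto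
    also have "\<dots> \<le> n" unfolding walks_0 by (metis card_image_le card_lessThan finite_lessThan)
    also have "\<dots> \<le> n ^ Suc r" using False by simp
    finally show ?case by simp
  next
    case (Suc h)
    \<comment> \<open>The vertices that can be prepended to \<open>p\<close> without creating a
      letter. Below, \<open>Y\<close> covers the walks whose first step has a new letter, so that
      only \<open>r - 1\<close> remain for the rest, and \<open>Z\<close> covers the others.\<close>
    define old where "old = (\<lambda>p. {a. a < n \<and> g (Suc a + Suc (hd p)) \<in> set (letters g p)})"
    define Y where "Y = (\<lambda>(a, p). a # p) ` ({..<n} \<times> (if r = 0 then {} else ?X h (r - 1)))"
    define Z where "Z = (\<lambda>(p, a). a # p) ` (SIGMA p : ?X h r. old p)"
    define c where "c = n ^ Suc r * (1 + h * \<Delta>) ^ h"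
    have "?X (Suc h) r \<subseteq> Y \<union> Z"
    proof
      fix q assume q: "q \<in> ?X (Suc h) r"
      then obtain a p where ap: "q = a # p" "a < n" "p \<in> walks n h" unfolding walks_Suc by auto
      have "p \<noteq> []" using ap by (auto simp: walks_def)
      hence l: "letters g q = g (Suc a + Suc (hd p)) # letters g p" unfolding ap(1) by (rule letters_Cons)
      show "q \<in> Y \<union> Z"
      proof (cases "g (Suc a + Suc (hd p)) \<in> set (letters g p)")
        case True
        hence "(p, a) \<in> (SIGMA p : ?X h r. old p)"
          using q ap l by (auto simp: old_def insert_absorb)
        from imageI[OF this, of "\<lambda>(p, a). a # p"] show ?thesis unfolding Z_def ap(1) by simp
      next
        case nw: False
        hence "Suc (card (set (letters g p))) \<le> r" using q l by simp
        hence "(a, p) \<in> {..<n} \<times> (if r = 0 then {} else ?X h (r - 1))" using ap by auto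
        from imageI[OF this, of "\<lambda>(a, p). a # p"] show ?thesis unfolding Y_def ap(1) by simp
      qed
    qed
    moreover have "finite Y" "finite Z"
      using fin by (auto simp: Y_def Z_def old_def intro!: finite_imageI finite_SigmaI)
    ultimately have "card (?X (Suc h) r) \<le> card Y + card Z"
      by (meson card_Un_le card_mono finite_UnI le_trans)
    moreover have "card Y \<le> n ^ Suc r * (1 + h * \<Delta>) ^ h"
    proof -
      have "card Y \<le> card ({..<n} \<times> (if r = 0 then {} else ?X h (r - 1)))"
        unfolding Y_def by (intro card_image_le) (use fin in auto)
      also have "\<dots> \<le> n * (n ^ r * (1 + h * \<Delta>) ^ h)"
      proof (cases r)
        case (Suc r')
        thus ?thesis using Suc.IH[of r'] by (simp add: card_cartesian_product)
      qed simp
      finally show ?thesis by simp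
    qed
    moreover have "card Z \<le> n ^ Suc r * (1 + h * \<Delta>) ^ h * (h * \<Delta>)"
    proof -
      have old: "card (old p) \<le> h * \<Delta>" if "p \<in> ?X h r" for p
      proof -
        have "old p = (\<Union>l\<in>set (letters g p). {a. a < n \<and> g (Suc a + Suc (hd p)) = l})"
          by (auto simp: old_def)
        hence "card (old p) \<le> (\<Sum>l\<in>set (letters g p). card {a. a < n \<and> g (Suc a + Suc (hd p)) = l})"
          by (simp add: card_UN_le)
        also have "\<dots> \<le> (\<Sum>l\<in>set (letters g p). \<Delta>)"
          using fib by (intro sum_mono) (auto simp: fibre_bound_def)
        also have "\<dots> \<le> length (letters g p) * \<Delta>" by (simp add: card_length)
        finally show ?thesis using that by (simp add: length_steps walks_def)
      qed
      have "card Z \<le> card (SIGMA p : ?X h r. old p)"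
        unfolding Z_def by (intro card_image_le finite_SigmaI fin) (auto simp: old_def)
      also have "\<dots> = (\<Sum>p\<in>?X h r. card (old p))"
        using fin by (intro card_SigmaI) (auto simp: old_def)
      also have "\<dots> \<le> card (?X h r) * (h * \<Delta>)"
        using sum_bounded_above[of "?X h r" "\<lambda>p. card (old p)" "h * \<Delta>"] old by simp
      also have "\<dots> \<le> n ^ Suc r * (1 + h * \<Delta>) ^ h * (h * \<Delta>)"
        by (intro mult_right_mono Suc.IH) simp
      finally show ?thesis .
    qed
    ultimately have "card (?X (Suc h) r) \<le> c * (1 + h * \<Delta>)"
      unfolding c_def[symmetric] by (simp add: algebra_simps)
    also have "\<dots> = n ^ Suc r * (1 + h * \<Delta>) ^ Suc h"
      unfolding c_def power_Suc2[of "1 + h * \<Delta>"] by (rule mult.assoc)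
    also have "\<dots> \<le> n ^ Suc r * (1 + Suc h * \<Delta>) ^ Suc h"
      by (intro mult_left_mono power_mono) auto
    finally show ?case .
  qed
qed

lemma card_set_le_half:
  assumes "\<And>a. a \<in> set ls \<Longrightarrow> count_list ls a \<ge> 2"
  shows "2 * card (set ls) \<le> length ls"
proof -
  have "2 * card (set ls) = (\<Sum>a\<in>set ls. 2)" by simp
  also have "\<dots> \<le> (\<Sum>a\<in>set ls. count_list ls a)" using assms by (intro sum_mono) auto
  also have "\<dots> = length ls" by (rule sum_count_set) auto
  finally show ?thesis .
qed

lemma card_set_less_half:
  assumes "\<And>a. a \<in> set ls \<Longrightarrow> count_list ls a \<ge> 2" and "b \<in> set ls" "count_list ls b \<noteq> 2"
  shows "2 * card (set ls) < length ls"
proof -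
  have "2 * card (set ls) = (\<Sum>a\<in>set ls. 2)" by simp
  also have "\<dots> < (\<Sum>a\<in>set ls. count_list ls a)"
    using assms by (intro sum_strict_mono_ex1) (auto intro!: bexI[of _ b] simp: le_neq_implies_less)
  also have "\<dots> = length ls" by (rule sum_count_set) auto
  finally show ?thesis .
qed

text \<open>A nonzero even multiplicity is at least 2, so an even walk of \<open>2 * k\<close> steps
  has at most \<open>k\<close> letters. The resulting bound on normalized counts is uniform in
  \<open>n\<close>, and it is applied to the orders \<open>2 * k\<close> and
  \<open>4 * k\<close>.\<close>

lemma card_even_walks:
  assumes "fibre_bound \<Delta> g n"
  shows "card (even_walks g n (2 * k)) \<le> n ^ Suc k * (1 + 2 * k * \<Delta>) ^ (2 * k)"
proof -
  have "even_walks g n (2 * k) \<subseteq> {p \<in> walks n (2 * k). card (set (letters g p)) \<le> k}"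
  proof
    fix p assume p: "p \<in> even_walks g n (2 * k)"
    hence w: "p \<in> walks n (2 * k)" by (simp add: even_walks_def closed_walks_def)
    have "count_list (letters g p) a \<ge> 2" if "a \<in> set (letters g p)" for a
    proof -
      have "count_list (letters g p) a \<noteq> 0" using that by (simp add: count_list_0_iff)
      moreover have "even (count_list (letters g p) a)" using p by (simp add: even_walks_def)
      ultimately show ?thesis by (auto elim!: evenE)
    qed
    hence "2 * card (set (letters g p)) \<le> length (letters g p)" by (rule card_set_le_half)
    thus "p \<in> {p \<in> walks n (2 * k). card (set (letters g p)) \<le> k}"
      using w by (auto simp: length_steps walks_def)
  qed
  hence "card (even_walks g n (2 * k)) \<le> card {p \<in> walks n (2 * k). card (set (letters g p)) \<le> k}"
    by (intro card_mono) (auto intro: finite_subset[OF _ finite_walks[of n "2 * k"]])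
  also have "\<dots> \<le> n ^ Suc k * (1 + 2 * k * \<Delta>) ^ (2 * k)" by (rule card_few_letters[OF assms])
  finally show ?thesis .
qed

section \<open>Dependence of the even walks on the link\<close>

lemma letters_comp: "letters (\<lambda>s. f (g s)) p = map f (letters g p)"
  by (induction p rule: induct_list012) auto

text \<open>The multiplicity of \<open>b\<close> is the sum of the multiplicities over its preimages
  under \<open>f\<close>.\<close>

lemma even_count_map:
  assumes "\<And>a. even (count_list ls a)"
  shows "even (count_list (map f ls) b)"
proof -
  have "count_list (map f ls) b = (\<Sum>a\<in>set ls. if f a = b then count_list ls a else 0)"
  proof -
    have "count_list (map f ls) b = (\<Sum>a\<leftarrow>ls. if f a = b then 1 else 0)"
      by (induction ls) simp_all
    also have "\<dots> = (\<Sum>a\<in>set ls. count_list ls a * (if f a = b then 1 else 0))"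
      by (rule sum_list_map_eq_sum_count)
    finally show ?thesis by (simp add: if_distrib cong: if_cong)
  qed
  also have "even \<dots>" using assms by (intro dvd_sum) auto
  finally show ?thesis .
qed

text \<open>The finite comparison behind the final inequality: a coarser link merges letters, and
  merged multiplicities add up.\<close>

lemma even_walks_comp_mono: "even_walks g n h \<subseteq> even_walks (\<lambda>s. f (g s)) n h"
proof
  fix p assume p: "p \<in> even_walks g n h"
  have "even (count_list (letters (\<lambda>s. f (g s)) p) b)" for b
    unfolding letters_comp[of f g] by (rule even_count_map) (use p in \<open>simp add: even_walks_def\<close>)
  with p show "p \<in> even_walks (\<lambda>s. f (g s)) n h" unfolding even_walks_def by simp
qed

lemma letters_subset: "set p \<subseteq> {..<n} \<Longrightarrow> set (letters (\<lambda>s. s) p) \<subseteq> {2..2 * n}"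
  by (induction p rule: induct_list012) auto

lemma letters_cong_walks:
  assumes p: "p \<in> walks n h" and gg: "\<And>s. 2 \<le> s \<Longrightarrow> s \<le> 2 * n \<Longrightarrow> g s = g' s"
  shows "letters g p = letters g' p"
proof -
  have "letters g p = map g (letters (\<lambda>s. s) p)" by (rule letters_comp)
  also have "\<dots> = map g' (letters (\<lambda>s. s) p)"
  proof (rule map_cong[OF refl])
    fix s assume "s \<in> set (letters (\<lambda>s. s) p)"
    hence "s \<in> {2..2 * n}" using letters_subset[of p n] p unfolding walks_def by blast
    thus "g s = g' s" using gg by simp
  qed
  also have "\<dots> = letters g' p" by (rule letters_comp[symmetric])
  finally show ?thesis .
qed

text \<open>A left inverse of \<open>g\<close> on \<open>{2..2 * n}\<close> is again a coarsening,
  so monotonicity also gives the reverse inclusion. Its values elsewhere are irrelevant, since every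
  index sum on a walk lies in that interval.\<close>

lemma even_walks_inj:
  assumes inj: "inj_on g {2..2 * n}"
  shows "even_walks g n h = even_walks (\<lambda>s. s) n h"
proof
  show "even_walks (\<lambda>s. s) n h \<subseteq> even_walks g n h" by (rule even_walks_comp_mono)
  define f where "f = the_inv_into {2..2 * n} g"
  have "even_walks g n h \<subseteq> even_walks (\<lambda>s. f (g s)) n h" by (rule even_walks_comp_mono)
  also have "\<dots> = even_walks (\<lambda>s. s) n h"
  proof -
    have "letters (\<lambda>s. f (g s)) p = letters (\<lambda>s. s) p" if "p \<in> walks n h" for p
      using that by (rule letters_cong_walks) (auto simp: f_def the_inv_into_f_f[OF inj])
    moreover have "p \<in> walks n h" if "p \<in> closed_walks n h" for p
      using that unfolding closed_walks_def by blast
    ultimately have "(\<forall>a. even (count_list (letters (\<lambda>s. f (g s)) p) a)) \<longleftrightarrow> (\<forall>a. even (count_list (letters (\<lambda>s. s) p) a))"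
      if "p \<in> closed_walks n h" for p using that by metis
    thus ?thesis unfolding even_walks_def by blast
  qed
  finally show "even_walks g n h \<subseteq> even_walks (\<lambda>s. s) n h" .
qed

section \<open>Expected traces of patterned matrices\<close>

text \<open>\<open>u\<close> is a single realization of the input. Spectral statistics thereby
  become functions on the space of sequences, where their continuity can be discussed.\<close>

definition link_matrix :: "(nat \<Rightarrow> nat) \<Rightarrow> nat \<Rightarrow> (nat \<Rightarrow> real) \<Rightarrow> real mat" where
  "link_matrix g n u = mat n n (\<lambda>(i, j). u (g (Suc i + Suc j)) / sqrt (real n))"

lemma link_matrix_carrier [simp]: "link_matrix g n u \<in> carrier_mat n n"
  by (simp add: link_matrix_def)

lemma link_matrix_index:
  "i < n \<Longrightarrow> j < n \<Longrightarrow> link_matrix g n u $$ (i,j) = u (g (Suc i + Suc j)) / sqrt (real n)"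
  by (simp add: link_matrix_def)

lemma link_matrix_sym:
  "i < n \<Longrightarrow> j < n \<Longrightarrow> link_matrix g n u $$ (i,j) = link_matrix g n u $$ (j,i)"
  by (simp add: link_matrix_index add.commute)

lemma prod_steps_link_matrix:
  "set p \<subseteq> {..<n} \<Longrightarrow> prod_list (steps (\<lambda>i j. link_matrix g n u $$ (i,j)) p)
     = prod_list (map u (letters g p)) / sqrt (real n) ^ (length p - 1)"
  by (induction p rule: induct_list012) (auto simp: link_matrix_index)

lemma spectral_sum_link_matrix:
  assumes "n > 0"
  shows "spectral_sum (\<lambda>a. a ^ (2 * k)) (link_matrix g n u)
       = (\<Sum>p\<in>closed_walks n (2 * k). prod_list (map u (letters g p))) / real n ^ k"
proof -
  have "spectral_sum (\<lambda>a. a ^ (2 * k)) (link_matrix g n u)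
      = (\<Sum>p\<in>closed_walks n (2 * k). prod_list (steps (\<lambda>i j. link_matrix g n u $$ (i,j)) p))"
    by (intro spectral_sum_power link_matrix_sym) auto
  also have "\<dots> = (\<Sum>p\<in>closed_walks n (2 * k). prod_list (map u (letters g p)) / real n ^ k)"
  proof (rule sum.cong[OF refl])
    fix p assume "p \<in> closed_walks n (2 * k)"
    hence p: "set p \<subseteq> {..<n}" "length p - 1 = 2 * k" by (auto simp: closed_walks_def walks_def)
    have "sqrt (real n) ^ (2 * k) = real n ^ k" by (simp add: power_mult)
    thus "prod_list (steps (\<lambda>i j. link_matrix g n u $$ (i,j)) p) = prod_list (map u (letters g p)) / real n ^ k"
      by (simp only: prod_steps_link_matrix[OF p(1)] p(2))
  qed
  finally show ?thesis by (simp only: sum_divide_distrib)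
qed

lemma prod_list_map_count:
  "prod_list (map u ls) = (\<Prod>a\<in>set ls. (u a :: real) ^ count_list ls a)"
  using image_prod_mset_multiplicity[of u "mset ls"]
  by (simp add: count_mset prod_mset_prod_list[symmetric] del: prod_mset_prod_list)

text \<open>The inputs to which the moment method applies directly. Uniformly bounded inputs are of
  this kind; i.i.d. inputs with too few moments are approximated by such sequences.\<close>

locale standard_sequence = prob_space M for M :: "'a measure" +
  fixes y :: "nat \<Rightarrow> 'a \<Rightarrow> real"
  assumes indep: "indep_vars (\<lambda>_. borel) y UNIV"
    and std: "standardized M y"
    and moments: "uniformly_bounded_moments M y"
begin

lemma measurable_y [measurable]: "y i \<in> borel_measurable M"
  using indep unfolding indep_vars_def by auto

lemma integrable_abs_power: "integrable M (\<lambda>\<omega>. \<bar>y i \<omega>\<bar> ^ c)"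
  using moments unfolding uniformly_bounded_moments_def by blast

lemma integrable_power: "integrable M (\<lambda>\<omega>. y i \<omega> ^ c)"
  by (rule Bochner_Integration.integrable_bound[OF integrable_abs_power[of i c]]) (auto simp: power_abs)

lemma expectation_1: "expectation (y i) = 0"
  using std by (simp add: standardized_def)

lemma expectation_2: "expectation (\<lambda>\<omega>. y i \<omega> ^ 2) = 1"
  using std expectation_1 by (simp add: standardized_def)

lemma indep_powers: "indep_vars (\<lambda>_. borel) (\<lambda>a \<omega>. y a \<omega> ^ c a) I"
  by (rule indep_vars_compose2[OF indep_vars_subset[OF indep subset_UNIV]]) auto

lemma integrable_prod_list: "integrable M (\<lambda>\<omega>. prod_list (map (\<lambda>a. y a \<omega>) ls))"
  unfolding prod_list_map_count
  by (rule indep_vars_integrable[OF _ indep_powers]) (auto intro: integrable_power)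

lemma expectation_prod_list:
  "expectation (\<lambda>\<omega>. prod_list (map (\<lambda>a. y a \<omega>) ls))
     = (\<Prod>a\<in>set ls. expectation (\<lambda>\<omega>. y a \<omega> ^ count_list ls a))"
  unfolding prod_list_map_count
  by (rule indep_vars_lebesgue_integral[OF _ indep_powers]) (auto intro: integrable_power)

lemma expectation_prod_list_singleton:
  assumes "count_list ls a = 1"
  shows "expectation (\<lambda>\<omega>. prod_list (map (\<lambda>a. y a \<omega>) ls)) = 0"
proof -
  have "a \<in> set ls" using assms by (metis count_notin zero_neq_one)
  moreover have "expectation (\<lambda>\<omega>. y a \<omega> ^ count_list ls a) = 0" by (simp add: assms expectation_1)
  ultimately show ?thesis unfolding expectation_prod_list by (intro prod_zero) auto
qed

lemma expectation_prod_list_pairs: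
  assumes "\<And>a. a \<in> set ls \<Longrightarrow> count_list ls a = 2"
  shows "expectation (\<lambda>\<omega>. prod_list (map (\<lambda>a. y a \<omega>) ls)) = 1"
  unfolding expectation_prod_list
  by (intro prod.neutral ballI) (simp only: assms expectation_2)

text \<open>\<open>K\<close> may depend on the number of factors but not on the letters, so the same
  bound serves every walk.\<close>

lemma expectation_prod_list_bound:
  "\<exists>K\<ge>0. \<forall>ls. length ls = h \<longrightarrow> \<bar>expectation (\<lambda>\<omega>. prod_list (map (\<lambda>a. y a \<omega>) ls))\<bar> \<le> K"
proof -
  have "\<forall>c. \<exists>C. \<forall>i. expectation (\<lambda>\<omega>. \<bar>y i \<omega>\<bar> ^ c) \<le> C"
    using moments unfolding uniformly_bounded_moments_def by blast
  then obtain C where C: "\<And>c i. expectation (\<lambda>\<omega>. \<bar>y i \<omega>\<bar> ^ c) \<le> C c" by metis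
  \<comment> \<open>The summand 1 ensures \<open>D \<ge> 1\<close>, so that the power
    \<open>card (set ls)\<close> can be raised to \<open>h\<close>.\<close>
  define D where "D = 1 + (\<Sum>c\<le>h. \<bar>C c\<bar>)"
  have D1: "D \<ge> 1" by (simp add: D_def sum_nonneg)
  have "\<bar>expectation (\<lambda>\<omega>. prod_list (map (\<lambda>a. y a \<omega>) ls))\<bar> \<le> D ^ h" if "length ls = h" for ls
  proof -
    have "\<bar>expectation (\<lambda>\<omega>. prod_list (map (\<lambda>a. y a \<omega>) ls))\<bar>
        = (\<Prod>a\<in>set ls. \<bar>expectation (\<lambda>\<omega>. y a \<omega> ^ count_list ls a)\<bar>)"
      unfolding expectation_prod_list by (rule abs_prod)
    also have "\<dots> \<le> (\<Prod>a\<in>set ls. D)"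
    proof (intro prod_mono conjI abs_ge_zero)
      fix a
      have "\<bar>expectation (\<lambda>\<omega>. y a \<omega> ^ count_list ls a)\<bar> \<le> expectation (\<lambda>\<omega>. \<bar>y a \<omega> ^ count_list ls a\<bar>)"
        by (rule integral_abs_bound)
      also have "\<dots> \<le> C (count_list ls a)" using C by (simp add: power_abs)
      also have "\<dots> \<le> \<bar>C (count_list ls a)\<bar>" by simp
      also have "\<dots> \<le> (\<Sum>c\<le>h. \<bar>C c\<bar>)"
        by (rule member_le_sum) (use that count_le_length[of ls a] in auto)
      also have "\<dots> \<le> D" by (simp add: D_def)
      finally show "\<bar>expectation (\<lambda>\<omega>. y a \<omega> ^ count_list ls a)\<bar> \<le> D" .
    qed
    also have "\<dots> = D ^ card (set ls)" by simp
    also have "\<dots> \<le> D ^ h" using D1 that card_length[of ls] by (intro power_increasing) auto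
    finally show ?thesis .
  qed
  thus ?thesis using D1 by (intro exI[of _ "D ^ h"]) auto
qed

lemma integrable_spectral_power:
  assumes "n > 0"
  shows "integrable M (\<lambda>\<omega>. spectral_sum (\<lambda>a. a ^ (2 * k)) (link_matrix g n (\<lambda>i. y i \<omega>)))"
  unfolding spectral_sum_link_matrix[OF assms]
  by (intro Bochner_Integration.integrable_divide_zero Bochner_Integration.integrable_sum integrable_prod_list)

text \<open>\<open>K\<close> is chosen before \<open>g\<close> and \<open>n\<close>, so the error
  tends to 0 even when the link changes with \<open>n\<close>.\<close>

lemma expectation_spectral_power:
  assumes k: "k \<ge> 1"
  shows "\<exists>K. \<forall>g n. n > 0 \<longrightarrow> fibre_bound \<Delta> g n \<longrightarrow>
    \<bar>expectation (\<lambda>\<omega>. spectral_sum (\<lambda>a. a ^ (2 * k)) (link_matrix g n (\<lambda>i. y i \<omega>)) / real n)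
      - real (card (even_walks g n (2 * k))) / real n ^ Suc k\<bar> \<le> K / real n"
proof -
  from expectation_prod_list_bound[of "2 * k"] obtain K where K0: "K \<ge> 0"
    and K: "\<And>ls. length ls = 2 * k \<Longrightarrow> \<bar>expectation (\<lambda>\<omega>. prod_list (map (\<lambda>a. y a \<omega>) ls))\<bar> \<le> K"
    by blast
  define K' where "K' = (K + 1) * real ((1 + 2 * k * \<Delta>) ^ (2 * k))"
  have "\<bar>expectation (\<lambda>\<omega>. spectral_sum (\<lambda>a. a ^ (2 * k)) (link_matrix g n (\<lambda>i. y i \<omega>)) / real n)
      - real (card (even_walks g n (2 * k))) / real n ^ Suc k\<bar> \<le> K' / real n"
    if n: "n > 0" and fib: "fibre_bound \<Delta> g n" for g n
  proof -
    define e where "e = (\<lambda>p. expectation (\<lambda>\<omega>. prod_list (map (\<lambda>a. y a \<omega>) (letters g p))))"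
    define \<nu> where "\<nu> = (\<lambda>p. if p \<in> even_walks g n (2 * k) then 1 else 0 :: real)"
    \<comment> \<open>The walks with too few letters to be all paired. There are only
      \<open>O(n ^ k)\<close> of them, against the normalization \<open>n ^ Suc k\<close>.\<close>
    define Bad where "Bad = {p \<in> walks n (2 * k). card (set (letters g p)) \<le> k - 1}"
    let ?W = "closed_walks n (2 * k)"
    have E: "expectation (\<lambda>\<omega>. spectral_sum (\<lambda>a. a ^ (2 * k)) (link_matrix g n (\<lambda>i. y i \<omega>)) / real n)
        = (\<Sum>p\<in>?W. e p) / real n ^ Suc k"
      unfolding spectral_sum_link_matrix[OF n] e_def
      by (simp add: Bochner_Integration.integral_sum integrable_prod_list)
    have N: "real (card (even_walks g n (2 * k))) = (\<Sum>p\<in>?W. \<nu> p)"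
    proof -
      have "(\<Sum>p\<in>?W. \<nu> p) = (\<Sum>p\<in>?W \<inter> even_walks g n (2 * k). 1)"
        unfolding \<nu>_def by (subst sum.inter_restrict) auto
      also have "?W \<inter> even_walks g n (2 * k) = even_walks g n (2 * k)" by (auto simp: even_walks_def)
      finally show ?thesis by simp
    qed
    \<comment> \<open>Outside \<open>Bad\<close> the expectation is exactly the indicator of
      evenness. A letter occurring once makes both vanish; otherwise every letter occurs at least
      twice, and a multiplicity above 2 would force fewer than \<open>k\<close> letters.\<close>
    have good: "e p = \<nu> p" if p: "p \<in> ?W" "p \<notin> Bad" for p
    proof (cases "\<exists>a. count_list (letters g p) a = 1")
      case True
      then obtain a where a: "count_list (letters g p) a = 1" by blast
      hence "p \<notin> even_walks g n (2 * k)" unfolding even_walks_def by (auto intro!: exI[of _ a])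
      thus ?thesis using expectation_prod_list_singleton[OF a] by (simp add: e_def \<nu>_def)
    next
      case False
      have ge2: "count_list (letters g p) a \<ge> 2" if "a \<in> set (letters g p)" for a
      proof -
        have "count_list (letters g p) a \<noteq> 0" using that by (simp only: count_list_0_iff) simp
        moreover have "count_list (letters g p) a \<noteq> 1" using False by blast
        ultimately show ?thesis by linarith
      qed
      have len: "length (letters g p) = 2 * k" using p by (simp add: length_steps closed_walks_def walks_def)
      have eq2: "count_list (letters g p) a = 2" if "a \<in> set (letters g p)" for a
      proof (rule ccontr)
        assume "count_list (letters g p) a \<noteq> 2"
        from card_set_less_half[OF ge2 that this] have "2 * card (set (letters g p)) < 2 * k" by (simp only: len)
        hence "card (set (letters g p)) \<le> k - 1" by linarith
        thus False using p by (auto simp: Bad_def closed_walks_def)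
      qed
      have "even (count_list (letters g p) a)" for a
      proof (cases "a \<in> set (letters g p)")
        case True
        show ?thesis by (subst eq2[OF True]) simp
      next
        case False
        show ?thesis by (subst count_notin[OF False]) simp
      qed
      hence "\<nu> p = 1" using p by (simp add: \<nu>_def even_walks_def)
      thus ?thesis using expectation_prod_list_pairs[OF eq2] by (simp add: e_def)
    qed
    have diff: "\<bar>e p - \<nu> p\<bar> \<le> (if p \<in> Bad then K + 1 else 0)" if p: "p \<in> ?W" for p
    proof (cases "p \<in> Bad")
      case True
      have "length (letters g p) = 2 * k" using p by (simp add: length_steps closed_walks_def walks_def)
      hence "\<bar>e p\<bar> \<le> K" unfolding e_def by (rule K)
      moreover have "\<bar>\<nu> p\<bar> \<le> 1" by (simp add: \<nu>_def)
      ultimately show ?thesis using True by simp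
    qed (use good p in simp)
    have finB: "finite Bad" unfolding Bad_def by (rule finite_subset[OF _ finite_walks[of n "2 * k"]]) auto
    have "\<bar>(\<Sum>p\<in>?W. e p) - (\<Sum>p\<in>?W. \<nu> p)\<bar> \<le> (\<Sum>p\<in>?W. \<bar>e p - \<nu> p\<bar>)"
      unfolding sum_subtractf[symmetric] by (rule sum_abs)
    also have "\<dots> \<le> (\<Sum>p\<in>?W. if p \<in> Bad then K + 1 else 0)" by (intro sum_mono diff)
    also have "\<dots> = real (card (?W \<inter> Bad)) * (K + 1)" by (simp add: sum.inter_restrict[symmetric])
    also have "\<dots> \<le> real (n ^ Suc (k - 1) * (1 + 2 * k * \<Delta>) ^ (2 * k)) * (K + 1)"
    proof (rule mult_right_mono)
      have "card (?W \<inter> Bad) \<le> card Bad" using finB by (intro card_mono) auto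
      also have "\<dots> \<le> n ^ Suc (k - 1) * (1 + 2 * k * \<Delta>) ^ (2 * k)"
        unfolding Bad_def by (rule card_few_letters[OF fib])
      finally show "real (card (?W \<inter> Bad)) \<le> real (n ^ Suc (k - 1) * (1 + 2 * k * \<Delta>) ^ (2 * k))"
        by (rule of_nat_mono)
    qed (use K0 in simp)
    also have "\<dots> = K' * real n ^ k" using k by (simp add: K'_def)
    finally have main: "\<bar>(\<Sum>p\<in>?W. e p) - (\<Sum>p\<in>?W. \<nu> p)\<bar> \<le> K' * real n ^ k" .
    have "\<bar>(\<Sum>p\<in>?W. e p) / real n ^ Suc k - (\<Sum>p\<in>?W. \<nu> p) / real n ^ Suc k\<bar>
        = \<bar>(\<Sum>p\<in>?W. e p) - (\<Sum>p\<in>?W. \<nu> p)\<bar> / real n ^ Suc k"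
      by (simp add: diff_divide_distrib[symmetric] abs_divide)
    also have "\<dots> \<le> K' * real n ^ k / real n ^ Suc k" by (rule divide_right_mono[OF main]) simp
    also have "\<dots> = K' / real n" using n by simp
    finally show ?thesis unfolding E N .
  qed
  thus ?thesis by blast
qed

end

section \<open>Truncation of the input\<close>

lemma (in prob_space) uniformly_bounded_imp_moments:
  fixes y :: "nat \<Rightarrow> 'a \<Rightarrow> real"
  assumes meas: "\<And>i. y i \<in> borel_measurable M" and bdd: "uniformly_bounded M y"
  shows "uniformly_bounded_moments M y"
  unfolding uniformly_bounded_moments_def
proof
  fix h
  from bdd obtain B where B: "\<And>i. AE \<omega> in M. \<bar>y i \<omega>\<bar> \<le> B" unfolding uniformly_bounded_def by blast
  have pow: "AE \<omega> in M. \<bar>y i \<omega>\<bar> ^ h \<le> B ^ h" for i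
    using B[of i] by eventually_elim (rule power_mono, auto)
  have int: "integrable M (\<lambda>\<omega>. \<bar>y i \<omega>\<bar> ^ h)" for i
    by (rule integrable_const_bound[where B = "B ^ h"]) (use pow[of i] meas in auto)
  have "expectation (\<lambda>\<omega>. \<bar>y i \<omega>\<bar> ^ h) \<le> expectation (\<lambda>_. B ^ h)" for i
    by (rule integral_mono_AE[OF int _ pow]) simp
  with int show "\<exists>C. \<forall>i. integrable M (\<lambda>\<omega>. \<bar>y i \<omega>\<bar> ^ h) \<and> expectation (\<lambda>\<omega>. \<bar>y i \<omega>\<bar> ^ h) \<le> C"
    by (intro exI[of _ "B ^ h"]) (simp add: prob_space)
qed

text \<open>Truncation at a high level, recentred and rescaled. With \<open>Z\<close> the truncation of \<open>X\<close>,
  \<open>m = E Z\<^sup>2\<close>, \<open>\<mu> = E Z\<close> and \<open>\<sigma>\<^sup>2 = m - \<mu>\<^sup>2\<close>, one has \<open>X Z = Z\<^sup>2\<close>, so that the squared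
  \<open>L\<^sup>2\<close> distance of \<open>X\<close> to \<open>(Z - \<mu>) / \<sigma>\<close> is exactly \<open>2 - 2 m / \<sigma>\<close>.\<close>

lemma (in prob_space) truncation:
  fixes X :: "'a \<Rightarrow> real"
  assumes X [measurable]: "X \<in> borel_measurable M"
    and int2: "integrable M (\<lambda>\<omega>. X \<omega> ^ 2)" and E1: "expectation X = 0" and E2: "expectation (\<lambda>\<omega>. X \<omega> ^ 2) = 1"
    and \<delta>: "\<delta> > 0"
  shows "\<exists>f B. f \<in> borel_measurable borel \<and> (\<forall>t. \<bar>f t\<bar> \<le> B) \<and>
           expectation (\<lambda>\<omega>. f (X \<omega>)) = 0 \<and> expectation (\<lambda>\<omega>. f (X \<omega>) ^ 2) = 1 \<and>
           expectation (\<lambda>\<omega>. (X \<omega> - f (X \<omega>)) ^ 2) \<le> \<delta>"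
proof -
  define z where "z = (\<lambda>(N::nat) t::real. if \<bar>t\<bar> \<le> real N then t else 0)"
  have z_meas [measurable]: "z N \<in> borel_measurable borel" for N unfolding z_def by measurable
  have z_bdd: "\<bar>z N t\<bar> \<le> real N" for N t by (simp add: z_def)
  have z_le: "\<bar>z N t\<bar> \<le> \<bar>t\<bar>" for N t by (simp add: z_def)
  \<comment> \<open>This identity is the reason for cutting to 0 beyond the level \<open>N\<close>
    instead of clipping at \<open>N\<close>.\<close>
  have tz: "t * z N t = z N t ^ 2" for N t by (simp add: z_def power2_eq_square)
  have int1: "integrable M X" by (rule square_integrable_imp_integrable[OF X int2])
  have z_lim: "(\<lambda>N. z N t) \<longlonglongrightarrow> t" for t
  proof (rule tendsto_eventually)
    have "eventually (\<lambda>N. \<bar>t\<bar> \<le> real N) sequentially"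
      using filterlim_real_sequentially by (auto simp: filterlim_at_top)
    thus "eventually (\<lambda>N. z N t = t) sequentially" by eventually_elim (simp add: z_def)
  qed
  define \<mu> where "\<mu> = (\<lambda>N. expectation (\<lambda>\<omega>. z N (X \<omega>)))"
  define m where "m = (\<lambda>N. expectation (\<lambda>\<omega>. z N (X \<omega>) ^ 2))"
  have intz: "integrable M (\<lambda>\<omega>. z N (X \<omega>))" for N
    by (rule integrable_const_bound[where B = "real N"]) (auto simp: z_bdd)
  have intz2: "integrable M (\<lambda>\<omega>. z N (X \<omega>) ^ 2)" for N
  proof (rule integrable_const_bound[where B = "real N ^ 2"])
    show "AE \<omega> in M. norm (z N (X \<omega>) ^ 2) \<le> real N ^ 2"
      using z_bdd[of N] by (auto simp: abs_le_square_iff[symmetric])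
  qed measurable
  have "\<mu> \<longlonglongrightarrow> expectation X"
    unfolding \<mu>_def
    by (rule integral_dominated_convergence[where w = "\<lambda>\<omega>. \<bar>X \<omega>\<bar>"])
       (use int1 z_lim z_le in auto)
  hence mu_lim: "\<mu> \<longlonglongrightarrow> 0" by (simp add: E1)
  have "m \<longlonglongrightarrow> expectation (\<lambda>\<omega>. X \<omega> ^ 2)"
    unfolding m_def
    by (rule integral_dominated_convergence[where w = "\<lambda>\<omega>. X \<omega> ^ 2"])
       (use int2 z_le in \<open>auto intro!: tendsto_power z_lim simp: abs_le_square_iff[symmetric]\<close>)
  hence m_lim: "m \<longlonglongrightarrow> 1" by (simp add: E2)
  \<comment> \<open>The variance of the truncated variable tends to 1, so it is positive for large
    \<open>N\<close> and the rescaling is legitimate.\<close>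
  have s_lim: "(\<lambda>N. m N - \<mu> N ^ 2) \<longlonglongrightarrow> 1"
    using tendsto_diff[OF m_lim tendsto_power[OF mu_lim, of 2]] by simp
  have d_lim: "(\<lambda>N. 2 - 2 * m N / sqrt (m N - \<mu> N ^ 2)) \<longlonglongrightarrow> 0"
    using tendsto_diff[OF tendsto_const[of 2] tendsto_divide[OF tendsto_mult[OF tendsto_const[of 2] m_lim] tendsto_real_sqrt[OF s_lim]]]
    by simp
  have "eventually (\<lambda>N. m N - \<mu> N ^ 2 > 0 \<and> 2 - 2 * m N / sqrt (m N - \<mu> N ^ 2) < \<delta>) sequentially"
  proof (rule eventually_conj)
    show "eventually (\<lambda>N. m N - \<mu> N ^ 2 > 0) sequentially" by (rule order_tendstoD(1)[OF s_lim]) simp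
    show "eventually (\<lambda>N. 2 - 2 * m N / sqrt (m N - \<mu> N ^ 2) < \<delta>) sequentially"
      by (rule order_tendstoD(2)[OF d_lim \<delta>])
  qed
  then obtain N where s: "m N - \<mu> N ^ 2 > 0" and d: "2 - 2 * m N / sqrt (m N - \<mu> N ^ 2) < \<delta>"
    by (auto simp: eventually_sequentially)
  define \<sigma> where "\<sigma> = sqrt (m N - \<mu> N ^ 2)"
  have \<sigma>: "\<sigma> > 0" "\<sigma> ^ 2 = m N - \<mu> N ^ 2" using s by (simp_all add: \<sigma>_def)
  define f where "f = (\<lambda>t. (z N t - \<mu> N) / \<sigma>)"
  have f_bdd: "\<bar>f t\<bar> \<le> (real N + \<bar>\<mu> N\<bar>) / \<sigma>" for t
    using z_bdd[of N t] \<sigma>(1) by (auto simp: f_def abs_divide intro!: divide_right_mono)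
  have f_meas [measurable]: "f \<in> borel_measurable borel" unfolding f_def by measurable
  have Ef: "expectation (\<lambda>\<omega>. f (X \<omega>)) = 0"
    using intz[of N] by (simp add: f_def \<mu>_def prob_space)
  have Ef2: "expectation (\<lambda>\<omega>. f (X \<omega>) ^ 2) = 1"
  proof -
    have "expectation (\<lambda>\<omega>. f (X \<omega>) ^ 2) = expectation (\<lambda>\<omega>. (z N (X \<omega>) ^ 2 - 2 * \<mu> N * z N (X \<omega>) + \<mu> N ^ 2) / \<sigma> ^ 2)"
      by (intro Bochner_Integration.integral_cong) (auto simp: f_def power_divide power2_diff)
    also have "\<dots> = (m N - 2 * \<mu> N * \<mu> N + \<mu> N ^ 2) / \<sigma> ^ 2"
      using intz intz2 by (simp add: \<mu>_def m_def prob_space)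
    also have "\<dots> = 1" using \<sigma> s by (simp add: power2_eq_square)
    finally show ?thesis .
  qed
  have intf2: "integrable M (\<lambda>\<omega>. f (X \<omega>) ^ 2)"
  proof (rule integrable_const_bound[where B = "((real N + \<bar>\<mu> N\<bar>) / \<sigma>) ^ 2"])
    show "AE \<omega> in M. norm (f (X \<omega>) ^ 2) \<le> ((real N + \<bar>\<mu> N\<bar>) / \<sigma>) ^ 2"
      using f_bdd \<sigma>(1) by (intro AE_I2) (simp add: abs_le_square_iff[symmetric] del: power_divide)
  qed measurable
  have Xf: "X \<omega> * f (X \<omega>) = (z N (X \<omega>) ^ 2 - \<mu> N * X \<omega>) / \<sigma>" for \<omega>
    by (simp add: f_def tz[symmetric] algebra_simps)
  have intXf: "integrable M (\<lambda>\<omega>. X \<omega> * f (X \<omega>))"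
    unfolding Xf using intz2 int1 by simp
  have EXf: "expectation (\<lambda>\<omega>. X \<omega> * f (X \<omega>)) = m N / \<sigma>"
    unfolding Xf using intz2 int1 by (simp add: m_def E1)
  have "expectation (\<lambda>\<omega>. (X \<omega> - f (X \<omega>)) ^ 2)
      = expectation (\<lambda>\<omega>. X \<omega> ^ 2 + f (X \<omega>) ^ 2 - 2 * (X \<omega> * f (X \<omega>)))"
    by (intro Bochner_Integration.integral_cong) (auto simp: power2_diff)
  also have "\<dots> = 2 - 2 * m N / \<sigma>"
    using int2 intf2 intXf by (simp add: E2 Ef2 EXf)
  also have "\<dots> \<le> \<delta>" using d by (simp add: \<sigma>_def)
  finally show ?thesis using f_meas f_bdd Ef Ef2 by blast
qed

text \<open>Inputs with bounded moments are their own approximation. For identically distributed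
  inputs a single truncation function works for every index, so independence and standardization
  survive and the \<open>L^2\<close> error is uniform.\<close>

lemma input_sequence_approx:
  fixes x :: "nat \<Rightarrow> 'a \<Rightarrow> real"
  assumes x: "input_sequence M x" and \<delta>: "\<delta> > 0"
  shows "\<exists>y. standard_sequence M y \<and>
    (\<forall>i. integrable M (\<lambda>\<omega>. (x i \<omega> - y i \<omega>) ^ 2) \<and> (\<integral>\<omega>. (x i \<omega> - y i \<omega>) ^ 2 \<partial>M) \<le> \<delta>)"
proof -
  interpret prob_space M using x by (simp add: input_sequence_def)
  have indep: "indep_vars (\<lambda>_. borel) x UNIV" and std: "standardized M x"
    using x by (simp_all add: input_sequence_def)
  have meas [measurable]: "x i \<in> borel_measurable M" for i
    using indep unfolding indep_vars_def by auto
  show ?thesis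
  proof (cases "uniformly_bounded_moments M x")
    case True
    hence "standard_sequence M x"
      using indep std by unfold_locales
    thus ?thesis using \<delta> by (intro exI[of _ x]) auto
  next
    case False
    hence "identically_distributed M x"
      using x uniformly_bounded_imp_moments[of x, OF meas] unfolding input_sequence_def by blast
    hence id: "distr M borel (x i) = distr M borel (x 0)" for i
      unfolding identically_distributed_def by blast
    have transfer: "expectation (\<lambda>\<omega>. h (x i \<omega>)) = expectation (\<lambda>\<omega>. h (x 0 \<omega>))"
      if "h \<in> borel_measurable borel" for h :: "real \<Rightarrow> real" and i
    proof -
      have "expectation (\<lambda>\<omega>. h (x i \<omega>)) = integral\<^sup>L (distr M borel (x i)) h"
        using that by (subst integral_distr) auto
      also have "\<dots> = expectation (\<lambda>\<omega>. h (x 0 \<omega>))"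
        unfolding id[of i] using that by (subst integral_distr) auto
      finally show ?thesis .
    qed
    have E1: "expectation (x i) = 0" for i using std by (simp add: standardized_def)
    have E2: "expectation (\<lambda>\<omega>. x i \<omega> ^ 2) = 1" for i
      using std E1[of i] by (auto simp: standardized_def dest: spec[of _ i])
    \<comment> \<open>A non-integrable function would have integral 0, not 1.\<close>
    have int2: "integrable M (\<lambda>\<omega>. x i \<omega> ^ 2)" for i
      using E2[of i] not_integrable_integral_eq by fastforce
    from truncation[OF meas int2 E1 E2 \<delta>, of 0] obtain f B where
      f [measurable]: "f \<in> borel_measurable borel" and B: "\<And>t. \<bar>f t\<bar> \<le> B"
      and f1: "expectation (\<lambda>\<omega>. f (x 0 \<omega>)) = 0" and f2: "expectation (\<lambda>\<omega>. f (x 0 \<omega>) ^ 2) = 1"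
      and fd: "expectation (\<lambda>\<omega>. (x 0 \<omega> - f (x 0 \<omega>)) ^ 2) \<le> \<delta>"
      by blast
    define y where "y = (\<lambda>i \<omega>. f (x i \<omega>))"
    have "indep_vars (\<lambda>_. borel) y UNIV"
      unfolding y_def by (rule indep_vars_compose2[OF indep]) simp
    moreover have "standardized M y"
    proof -
      have "expectation (y i) = 0" for i using transfer[OF f] f1 by (simp add: y_def)
      moreover have "expectation (\<lambda>\<omega>. y i \<omega> ^ 2) = 1" for i
        using transfer[of "\<lambda>t. f t ^ 2" i] f2 by (simp add: y_def)
      ultimately show ?thesis by (simp add: standardized_def)
    qed
    moreover have "uniformly_bounded_moments M y"
      by (rule uniformly_bounded_imp_moments) (use B in \<open>auto simp: y_def uniformly_bounded_def\<close>)
    ultimately have "standard_sequence M y" by unfold_locales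
    moreover have "integrable M (\<lambda>\<omega>. (x i \<omega> - y i \<omega>) ^ 2)" for i
    proof -
      have "integrable M (\<lambda>\<omega>. 2 * x i \<omega> ^ 2 + 2 * B ^ 2)" using int2 by simp
      thus ?thesis
      proof (rule Bochner_Integration.integrable_bound)
        show "AE \<omega> in M. norm ((x i \<omega> - y i \<omega>) ^ 2) \<le> norm (2 * x i \<omega> ^ 2 + 2 * B ^ 2)"
        proof (rule AE_I2)
          fix \<omega>
          have "y i \<omega> ^ 2 \<le> B ^ 2" using B[of "x i \<omega>"] unfolding y_def by (simp add: abs_le_square_iff[symmetric])
          moreover have "(x i \<omega> - y i \<omega>) ^ 2 + (x i \<omega> + y i \<omega>) ^ 2 = 2 * x i \<omega> ^ 2 + 2 * y i \<omega> ^ 2"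
            by (simp add: power2_eq_square algebra_simps)
          ultimately have "(x i \<omega> - y i \<omega>) ^ 2 \<le> 2 * x i \<omega> ^ 2 + 2 * B ^ 2"
            using zero_le_power2[of "x i \<omega> + y i \<omega>"] by linarith
          thus "norm ((x i \<omega> - y i \<omega>) ^ 2) \<le> norm (2 * x i \<omega> ^ 2 + 2 * B ^ 2)" by simp
        qed
      qed (simp add: y_def)
    qed
    moreover have "expectation (\<lambda>\<omega>. (x i \<omega> - y i \<omega>) ^ 2) \<le> \<delta>" for i
      using transfer[of "\<lambda>t. (t - f t) ^ 2" i] fd by (simp add: y_def)
    ultimately show ?thesis by blast
  qed
qed

lemma spectral_sum_bound:
  assumes A: "A \<in> carrier_mat n n" "\<And>i j. i < n \<Longrightarrow> j < n \<Longrightarrow> A $$ (i,j) = A $$ (j,i)"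
    and f: "\<And>t. \<bar>f t\<bar> \<le> h t"
  shows "\<bar>spectral_sum f A\<bar> \<le> spectral_sum h A"
proof -
  from symmetric_mat_diagonalization[OF A] obtain d :: "nat \<Rightarrow> real"
    where roots: "proots (char_poly A) = image_mset d (mset_set {..<n})" by blast
  show ?thesis unfolding spectral_sum_eq[OF roots]
    by (rule order.trans[OF sum_abs sum_mono]) (rule f)
qed

section \<open>Spectral statistics as random variables\<close>

lemma spectral_sum_link_lipschitz:
  assumes f: "\<And>s t. \<bar>f s - f t\<bar> \<le> L * \<bar>s - t\<bar>" and L: "L \<ge> 0" and \<delta>: "\<delta> > 0" and n: "n > 0"
  shows "\<bar>spectral_sum f (link_matrix g n u) - spectral_sum f (link_matrix g n v)\<bar>
       \<le> L / 2 * (real n * \<delta> + (\<Sum>i<n. \<Sum>j<n. (u (g (Suc i + Suc j)) - v (g (Suc i + Suc j)))\<^sup>2) / (real n * \<delta>))"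
proof -
  have "(\<Sum>i<n. \<Sum>j<n. (link_matrix g n u $$ (i,j) - link_matrix g n v $$ (i,j))\<^sup>2)
      = (\<Sum>i<n. \<Sum>j<n. (u (g (Suc i + Suc j)) - v (g (Suc i + Suc j)))\<^sup>2 / real n)"
    by (intro sum.cong refl) (simp add: link_matrix_index diff_divide_distrib[symmetric] power_divide)
  also have "\<dots> = (\<Sum>i<n. \<Sum>j<n. (u (g (Suc i + Suc j)) - v (g (Suc i + Suc j)))\<^sup>2) / real n"
    by (simp only: sum_divide_distrib)
  finally show ?thesis
    using spectral_sum_lipschitz[OF link_matrix_carrier link_matrix_sym link_matrix_carrier link_matrix_sym f \<delta> L, of n g u g v]
    by (simp only: divide_divide_eq_left)
qed

text \<open>Continuity is with respect to the product topology on \<open>nat \<Rightarrow> real\<close>; it yields measurability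
  of the spectral statistics without any discussion of the eigenvalues as functions of the matrix.\<close>

lemma continuous_spectral_sum_link:
  assumes f: "\<And>s t. \<bar>f s - f t\<bar> \<le> L * \<bar>s - t\<bar>" and L: "L \<ge> 0" and n: "n > 0"
  shows "continuous_on UNIV (\<lambda>u. spectral_sum f (link_matrix g n u))"
  unfolding continuous_on_def
proof (intro ballI tendstoI)
  fix u :: "nat \<Rightarrow> real" and e :: real assume e: "e > 0"
  \<comment> \<open>As \<open>v\<close> tends to \<open>u\<close> the coupling bound tends to
    \<open>L / 2 * (real n * \<delta>)\<close>, which this choice puts below \<open>e\<close>;
    \<open>L + 1\<close> avoids dividing by 0.\<close>
  define \<delta> where "\<delta> = e / (real n * (L + 1))"
  have \<delta>: "\<delta> > 0" using e L n by (simp add: \<delta>_def)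
  let ?B = "\<lambda>v. L / 2 * (real n * \<delta> + (\<Sum>i<n. \<Sum>j<n. (v (g (Suc i + Suc j)) - u (g (Suc i + Suc j)))\<^sup>2) / (real n * \<delta>))"
  have coord: "((\<lambda>v. v a) \<longlongrightarrow> u a) (at u)" for a
    using continuous_on_product_coordinates[of a] unfolding continuous_on_def by auto
  have "(?B \<longlongrightarrow> L / 2 * (real n * \<delta> + (\<Sum>i<n. \<Sum>j<n. (u (g (Suc i + Suc j)) - u (g (Suc i + Suc j)))\<^sup>2) / (real n * \<delta>))) (at u)"
    by (intro tendsto_intros coord) (use n \<delta> in auto)
  hence "(?B \<longlongrightarrow> L / 2 * (real n * \<delta>)) (at u)" by simp
  moreover have "L / 2 * (real n * \<delta>) < e"
  proof -
    have "real n * \<delta> = e / (L + 1)" using n by (simp add: \<delta>_def)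
    moreover have "L * e < (2 * (L + 1)) * e" using e L by (intro mult_strict_right_mono) auto
    ultimately show ?thesis using L by (simp add: pos_divide_less_eq mult_ac)
  qed
  ultimately have "eventually (\<lambda>v. ?B v < e) (at u)" by (rule order_tendstoD(2))
  thus "eventually (\<lambda>v. dist (spectral_sum f (link_matrix g n v)) (spectral_sum f (link_matrix g n u)) < e) (at u)"
  proof eventually_elim
    case (elim v)
    with spectral_sum_link_lipschitz[OF f L \<delta> n, of g v u] show ?case by (simp add: dist_real_def)
  qed
qed

lemma measurable_spectral_sum_link:
  assumes f: "\<And>s t. \<bar>f s - f t\<bar> \<le> L * \<bar>s - t\<bar>" and L: "L \<ge> 0" and n: "n > 0"
    and x: "\<And>i. x i \<in> borel_measurable M"
  shows "(\<lambda>\<omega>. spectral_sum f (link_matrix g n (\<lambda>i. x i \<omega>))) \<in> borel_measurable M"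
proof -
  have "(\<lambda>u. spectral_sum f (link_matrix g n u)) \<in> borel_measurable borel"
    by (rule borel_measurable_continuous_onI[OF continuous_spectral_sum_link[OF f L n]])
  moreover have "(\<lambda>\<omega> i. x i \<omega>) \<in> borel_measurable M"
    by (rule measurable_coordinatewise_then_product) (rule x)
  ultimately show ?thesis by (rule measurable_compose_rev)
qed

lemma spectral_sum_const_bound:
  assumes "\<And>t. \<bar>f t\<bar> \<le> B"
  shows "\<bar>spectral_sum f (link_matrix g n u)\<bar> \<le> real n * B"
proof -
  have "\<exists>U d. diagonalizes n U d (\<lambda>i j. link_matrix g n u $$ (i,j)) \<and>
              proots (char_poly (link_matrix g n u)) = image_mset d (mset_set {..<n})"
    by (intro symmetric_mat_diagonalization link_matrix_sym) auto
  then obtain d where roots: "proots (char_poly (link_matrix g n u)) = image_mset d (mset_set {..<n})" by blast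
  have "\<bar>spectral_sum f (link_matrix g n u)\<bar> \<le> spectral_sum (\<lambda>_. B) (link_matrix g n u)"
    by (intro spectral_sum_bound link_matrix_sym assms) auto
  thus ?thesis by (simp add: spectral_sum_eq[OF roots])
qed

text \<open>The coupling bound is integrated, with its free parameter equal to the bound
  \<open>\<delta>\<close> on the \<open>L^2\<close> distances of the inputs. Its two terms then
  balance, and the estimate depends neither on \<open>n\<close> nor on \<open>g\<close>.\<close>

lemma (in prob_space) expectation_spectral_sum_diff:
  assumes x: "\<And>i. x i \<in> borel_measurable M" and y: "\<And>i. y i \<in> borel_measurable M"
    and int: "\<And>i. integrable M (\<lambda>\<omega>. (x i \<omega> - y i \<omega>)\<^sup>2)"
    and d: "\<And>i. expectation (\<lambda>\<omega>. (x i \<omega> - y i \<omega>)\<^sup>2) \<le> \<delta>\<^sup>2"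
    and f: "\<And>s t. \<bar>f s - f t\<bar> \<le> L * \<bar>s - t\<bar>" and L: "L \<ge> 0" and B: "\<And>t. \<bar>f t\<bar> \<le> B"
    and \<delta>: "\<delta> > 0" and n: "n > 0"
  shows "\<bar>expectation (\<lambda>\<omega>. spectral_sum f (link_matrix g n (\<lambda>i. x i \<omega>)) / real n)
        - expectation (\<lambda>\<omega>. spectral_sum f (link_matrix g n (\<lambda>i. y i \<omega>)) / real n)\<bar> \<le> L * \<delta>"
proof -
  let ?S = "\<lambda>x \<omega>. spectral_sum f (link_matrix g n (\<lambda>i. x i \<omega>)) / real n"
  let ?Q = "\<lambda>\<omega>. \<Sum>i<n. \<Sum>j<n. (x (g (Suc i + Suc j)) \<omega> - y (g (Suc i + Suc j)) \<omega>)\<^sup>2"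
  have bdd: "\<bar>?S x \<omega>\<bar> \<le> B" for x :: "nat \<Rightarrow> 'a \<Rightarrow> real" and \<omega>
    using spectral_sum_const_bound[of f B g n "\<lambda>i. x i \<omega>", OF B] n by (simp add: field_simps abs_divide)
  have intS: "integrable M (?S x)" if "\<And>i. x i \<in> borel_measurable M" for x
  proof (rule integrable_const_bound[where B = B])
    show "AE \<omega> in M. norm (?S x \<omega>) \<le> B" using bdd[of x] by simp
    show "?S x \<in> borel_measurable M"
      using measurable_spectral_sum_link[OF f L n that] by simp
  qed
  have intQ: "integrable M ?Q" by (intro Bochner_Integration.integrable_sum int)
  have EQ: "expectation ?Q \<le> (real n * \<delta>)\<^sup>2"
  proof -
    have "expectation ?Q = (\<Sum>i<n. \<Sum>j<n. expectation (\<lambda>\<omega>. (x (g (Suc i + Suc j)) \<omega> - y (g (Suc i + Suc j)) \<omega>)\<^sup>2))"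
      by (simp only: Bochner_Integration.integral_sum Bochner_Integration.integrable_sum int)
    also have "\<dots> \<le> (\<Sum>i<n. \<Sum>j<n. \<delta>\<^sup>2)" by (intro sum_mono d)
    finally show ?thesis by (simp add: power2_eq_square mult_ac)
  qed
  have rescale: "L / 2 * (real n * \<delta> + q / (real n * \<delta>)) / real n = L / 2 * (\<delta> + q / (real n * real n * \<delta>))" for q
    using n \<delta> by (simp add: field_simps)
  have "\<bar>expectation (?S x) - expectation (?S y)\<bar> = \<bar>expectation (\<lambda>\<omega>. ?S x \<omega> - ?S y \<omega>)\<bar>"
    using intS[OF x] intS[OF y] by simp
  also have "\<dots> \<le> expectation (\<lambda>\<omega>. \<bar>?S x \<omega> - ?S y \<omega>\<bar>)" by (rule integral_abs_bound)
  also have "\<dots> \<le> expectation (\<lambda>\<omega>. L / 2 * (\<delta> + ?Q \<omega> / (real n * real n * \<delta>)))"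
  proof (rule integral_mono)
    show "integrable M (\<lambda>\<omega>. \<bar>?S x \<omega> - ?S y \<omega>\<bar>)" using intS[OF x] intS[OF y] by simp
    show "integrable M (\<lambda>\<omega>. L / 2 * (\<delta> + ?Q \<omega> / (real n * real n * \<delta>)))" using intQ by simp
    fix \<omega>
    have "\<bar>?S x \<omega> - ?S y \<omega>\<bar>
        = \<bar>spectral_sum f (link_matrix g n (\<lambda>i. x i \<omega>)) - spectral_sum f (link_matrix g n (\<lambda>i. y i \<omega>))\<bar> / real n"
      by (simp add: diff_divide_distrib[symmetric] abs_divide)
    also have "\<dots> \<le> L / 2 * (real n * \<delta> + ?Q \<omega> / (real n * \<delta>)) / real n"
      by (intro divide_right_mono spectral_sum_link_lipschitz[OF f L \<delta> n]) simp
    also have "\<dots> = L / 2 * (\<delta> + ?Q \<omega> / (real n * real n * \<delta>))"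
      by (rule rescale)
    finally show "\<bar>?S x \<omega> - ?S y \<omega>\<bar> \<le> L / 2 * (\<delta> + ?Q \<omega> / (real n * real n * \<delta>))" .
  qed
  also have "\<dots> = L / 2 * (\<delta> + expectation ?Q / (real n * real n * \<delta>))"
    using intQ by (simp add: prob_space)
  also have "\<dots> \<le> L / 2 * (\<delta> + (real n * \<delta>)\<^sup>2 / (real n * real n * \<delta>))"
    using L n \<delta> EQ by (intro mult_left_mono add_left_mono divide_right_mono) auto
  also have "\<dots> = L * \<delta>" using n \<delta> by (simp add: power2_eq_square)
  finally show ?thesis .
qed

text \<open>Dominated convergence turns almost sure weak convergence into convergence of
  expectations. As the limit is given to be non-random, expected traces suffice to identify it, with
  no variance estimate.\<close>

lemma expectation_spectral_sum_limit:
  fixes x :: "nat \<Rightarrow> 'a \<Rightarrow> real"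
  assumes M: "prob_space M" and x: "\<And>i. x i \<in> borel_measurable M"
    and lsd: "is_lsd M (\<lambda>n \<omega>. link_matrix (G n) n (\<lambda>i. x i \<omega>)) F"
    and f: "\<And>s t. \<bar>f s - f t\<bar> \<le> L * \<bar>s - t\<bar>" and L: "L \<ge> 0" and B: "\<And>t. \<bar>f t\<bar> \<le> B"
  shows "(\<lambda>n. \<integral>\<omega>. spectral_sum f (link_matrix (G n) n (\<lambda>i. x i \<omega>)) / real n \<partial>M) \<longlonglongrightarrow> integral\<^sup>L F f"
proof -
  interpret prob_space M by (rule M)
  let ?A = "\<lambda>n \<omega>. link_matrix (G n) n (\<lambda>i. x i \<omega>)"
  have F: "real_distribution F" and conv: "AE \<omega> in M. weak_conv (\<lambda>n. esd (?A n \<omega>)) (cdf F)"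
    using lsd by (simp_all add: is_lsd_def)
  have isCont: "isCont f t" for t
  proof -
    have "L-lipschitz_on UNIV f" using f L by (intro lipschitz_onI) (auto simp: dist_real_def)
    hence "continuous_on UNIV f" by (rule lipschitz_on_continuous_on)
    thus ?thesis by (simp add: continuous_on_eq_continuous_at)
  qed
  have f_meas: "f \<in> borel_measurable borel"
    using isCont by (intro borel_measurable_continuous_onI) (simp add: continuous_at_imp_continuous_on)
  have pointwise: "(\<lambda>n. spectral_sum f (?A n \<omega>) / real n) \<longlonglongrightarrow> integral\<^sup>L F f"
    if w: "weak_conv (\<lambda>n. esd (?A n \<omega>)) (cdf F)" for \<omega>
  proof -
    \<comment> \<open>At \<open>n = 0\<close> there is no spectrum to choose from; \<open>F\<close>
      fills that place in the sequence.\<close>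
    have "\<exists>\<mu>. real_distribution \<mu> \<and> (n > 0 \<longrightarrow> cdf \<mu> = esd (?A n \<omega>) \<and>
             (\<forall>f\<in>borel_measurable borel. integral\<^sup>L \<mu> f = spectral_sum f (?A n \<omega>) / real n))" for n
    proof (cases "n > 0")
      case True
      show ?thesis using esd_eq[OF link_matrix_carrier link_matrix_sym True] by blast
    qed (use F in blast)
    then obtain \<mu> where \<mu>: "\<And>n. real_distribution (\<mu> n)"
      and cdf: "\<And>n. n > 0 \<Longrightarrow> cdf (\<mu> n) = esd (?A n \<omega>)"
      and int: "\<And>n. n > 0 \<Longrightarrow> integral\<^sup>L (\<mu> n) f = spectral_sum f (?A n \<omega>) / real n"
      using f_meas by metis
    have "weak_conv_m \<mu> F"
      unfolding weak_conv_m_def weak_conv_def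
    proof (intro allI impI)
      fix t assume "isCont (cdf F) t"
      hence "(\<lambda>n. esd (?A n \<omega>) t) \<longlonglongrightarrow> cdf F t" using w by (simp add: weak_conv_def)
      thus "(\<lambda>n. cdf (\<mu> n) t) \<longlonglongrightarrow> cdf F t"
        by (rule Lim_transform_eventually)
           (use eventually_gt_at_top[of 0] in eventually_elim, simp add: cdf)
    qed
    hence "(\<lambda>n. integral\<^sup>L (\<mu> n) f) \<longlonglongrightarrow> integral\<^sup>L F f"
      by (rule weak_conv_imp_integral_bdd_continuous_conv[OF \<mu> F _ isCont]) (use B in auto)
    thus ?thesis
      by (rule Lim_transform_eventually)
         (use eventually_gt_at_top[of 0] in eventually_elim, simp add: int)
  qed
  have bdd: "\<bar>spectral_sum f (?A n \<omega>) / real n\<bar> \<le> B" for n \<omega>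
  proof (cases "n > 0")
    case True
    thus ?thesis using spectral_sum_const_bound[of f B "G n" n "\<lambda>i. x i \<omega>", OF B]
      by (simp add: field_simps abs_divide)
  next
    case False
    thus ?thesis using B[of 0] by simp
  qed
  have "(\<lambda>n. \<integral>\<omega>. spectral_sum f (?A n \<omega>) / real n \<partial>M) \<longlonglongrightarrow> (\<integral>\<omega>. integral\<^sup>L F f \<partial>M)"
  proof (rule integral_dominated_convergence[where w = "\<lambda>_. B"])
    show "(\<lambda>\<omega>. spectral_sum f (?A n \<omega>) / real n) \<in> borel_measurable M" for n
    proof (cases "n > 0")
      case True
      thus ?thesis using measurable_spectral_sum_link[OF f L True x] by simp
    qed simp
    show "AE \<omega> in M. (\<lambda>n. spectral_sum f (?A n \<omega>) / real n) \<longlonglongrightarrow> integral\<^sup>L F f"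
      using conv by eventually_elim (rule pointwise)
    show "AE \<omega> in M. norm (spectral_sum f (?A n \<omega>) / real n) \<le> B" for n
      using bdd by simp
  qed auto
  thus ?thesis by (simp add: prob_space)
qed

section \<open>Moments of the limiting spectral distribution\<close>

lemma power_diff_bound:
  fixes a b R :: real
  assumes "0 \<le> a" "a \<le> R" "0 \<le> b" "b \<le> R"
  shows "\<bar>a ^ m - b ^ m\<bar> \<le> real m * R ^ (m - 1) * \<bar>a - b\<bar>"
proof (induction m)
  case (Suc m)
  have R: "R \<ge> 0" using assms by linarith
  have "\<bar>a ^ Suc m - b ^ Suc m\<bar> = \<bar>a * (a ^ m - b ^ m) + (a - b) * b ^ m\<bar>"
    by (simp add: algebra_simps)
  also have "\<dots> \<le> \<bar>a\<bar> * \<bar>a ^ m - b ^ m\<bar> + \<bar>a - b\<bar> * \<bar>b ^ m\<bar>"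
    by (metis abs_mult abs_triangle_ineq)
  also have "\<dots> \<le> R * (real m * R ^ (m - 1) * \<bar>a - b\<bar>) + \<bar>a - b\<bar> * R ^ m"
    using assms R Suc.IH by (intro add_mono mult_mono) (auto simp: power_mono)
  also have "\<dots> = real (Suc m) * R ^ (Suc m - 1) * \<bar>a - b\<bar>"
    by (cases m) (simp_all add: algebra_simps)
  finally show ?case .
qed simp

definition capped_power :: "real \<Rightarrow> nat \<Rightarrow> real \<Rightarrow> real" where
  "capped_power R m t = min \<bar>t\<bar> R ^ m"

lemma capped_power_lipschitz:
  assumes "R \<ge> 0"
  shows "\<bar>capped_power R m s - capped_power R m t\<bar> \<le> real m * R ^ (m - 1) * \<bar>s - t\<bar>"
proof -
  have "\<bar>capped_power R m s - capped_power R m t\<bar> \<le> real m * R ^ (m - 1) * \<bar>min \<bar>s\<bar> R - min \<bar>t\<bar> R\<bar>"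
    unfolding capped_power_def using assms by (intro power_diff_bound) auto
  also have "\<dots> \<le> real m * R ^ (m - 1) * \<bar>s - t\<bar>"
    using assms by (intro mult_left_mono) (auto simp: min_def abs_if)
  finally show ?thesis .
qed

lemma capped_power_bound: "R \<ge> 0 \<Longrightarrow> \<bar>capped_power R m t\<bar> \<le> R ^ m"
  by (simp add: capped_power_def power_abs[symmetric] power_mono)

lemma capped_power_le: "R \<ge> 0 \<Longrightarrow> capped_power R (2 * k) t \<le> t ^ (2 * k)"
  using power_mono[of "min \<bar>t\<bar> R" "\<bar>t\<bar>" "2 * k"] by (simp add: capped_power_def power_mult)

text \<open>There is no error up to the cap. Beyond it the error is at most
  \<open>t ^ (2 * k)\<close>, and the factor \<open>t ^ (2 * k) / R ^ (2 * k)\<close> is at least 1.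
  This reduces the tail to a moment of order \<open>4 * k\<close>.\<close>

lemma capped_power_error:
  assumes R: "R > 0"
  shows "\<bar>capped_power R (2 * k) t - t ^ (2 * k)\<bar> \<le> t ^ (2 * (2 * k)) / R ^ (2 * k)"
proof (cases "\<bar>t\<bar> \<le> R")
  case True
  hence "capped_power R (2 * k) t = t ^ (2 * k)" by (simp add: capped_power_def power_mult)
  thus ?thesis using R by (simp add: power_mult)
next
  case False
  have ge0: "t ^ (2 * k) \<ge> 0" by (simp add: power_mult)
  have "R ^ (2 * k) \<le> \<bar>t\<bar> ^ (2 * k)" using R False by (intro power_mono) auto
  hence "R ^ (2 * k) \<le> t ^ (2 * k)" by (simp add: power_mult)
  hence "t ^ (2 * k) * R ^ (2 * k) \<le> t ^ (2 * k) * t ^ (2 * k)" using ge0 by (intro mult_left_mono)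
  hence "t ^ (2 * k) \<le> t ^ (2 * (2 * k)) / R ^ (2 * k)"
    using R by (simp add: pos_le_divide_eq power_add[symmetric] mult_2)
  moreover have "capped_power R (2 * k) t \<ge> 0" using R by (simp add: capped_power_def)
  ultimately show ?thesis using capped_power_le[of R k t] R by simp
qed

text \<open>The capped power passes to the limit by weak convergence, at a cost controlled by the
  moment of order \<open>4 * k\<close> of the approximating matrices. Removing the cap by monotone
  convergence avoids any assumption that \<open>F\<close> has moments.\<close>

theorem moment_lsd_link:
  fixes x :: "nat \<Rightarrow> 'a \<Rightarrow> real"
  assumes x: "input_sequence M x" and fib: "\<And>n. fibre_bound \<Delta> (G n) n"
    and lsd: "is_lsd M (\<lambda>n \<omega>. link_matrix (G n) n (\<lambda>i. x i \<omega>)) F" and k: "k \<ge> 1"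
  shows "(\<lambda>n. real (card (even_walks (G n) n (2 * k))) / real n ^ Suc k) \<longlonglongrightarrow> moment F (2 * k)"
proof -
  interpret prob_space M using x by (simp add: input_sequence_def)
  have x_meas: "x i \<in> borel_measurable M" for i
    using x unfolding input_sequence_def indep_vars_def by auto
  have F: "real_distribution F" using lsd by (simp add: is_lsd_def)
  interpret F: real_distribution F by (rule F)
  \<comment> \<open>The order remains a parameter, since the tail estimate needs
    \<open>c (2 * k)\<close> besides \<open>c k\<close>.\<close>
  define c where "c = (\<lambda>k n. real (card (even_walks (G n) n (2 * k))) / real n ^ Suc k)"
  define C where "C = (\<lambda>k. real ((1 + 2 * k * \<Delta>) ^ (2 * k)))"
  have c_le: "c k n \<le> C k" for k n
  proof (cases "n > 0")
    case True
    have "real (card (even_walks (G n) n (2 * k))) \<le> real (n ^ Suc k * (1 + 2 * k * \<Delta>) ^ (2 * k))"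
      by (rule of_nat_mono[OF card_even_walks[OF fib]])
    also have "\<dots> = C k * real n ^ Suc k" by (simp add: C_def)
    finally show ?thesis unfolding c_def using True by (subst pos_divide_le_eq) auto
  qed (simp add: c_def C_def)
  let ?\<phi> = "\<lambda>R. capped_power R (2 * k)"
  \<comment> \<open>Four errors of size \<open>\<epsilon> / 4\<close> add up: the limit of the
    expectations, the replacement of \<open>x\<close> by \<open>y\<close>, and the walk counts at
    orders \<open>2 * k\<close> and \<open>4 * k\<close>. The cap contributes the remaining
    term.\<close>
  have approx: "eventually (\<lambda>n. \<bar>integral\<^sup>L F (?\<phi> R) - c k n\<bar> \<le> C (2 * k) / R ^ (2 * k) + \<epsilon>) sequentially"
    if R: "R > 0" and \<epsilon>: "\<epsilon> > 0" for R \<epsilon>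
  proof -
    define L where "L = real (2 * k) * R ^ (2 * k - 1)"
    have L: "L \<ge> 0" using R by (simp add: L_def)
    have lip: "\<bar>?\<phi> R s - ?\<phi> R t\<bar> \<le> L * \<bar>s - t\<bar>" for s t
      unfolding L_def using R by (intro capped_power_lipschitz) simp
    have bdd: "\<bar>?\<phi> R t\<bar> \<le> R ^ (2 * k)" for t using R by (intro capped_power_bound) simp
    define \<delta> where "\<delta> = \<epsilon> / (4 * (L + 1))"
    have \<delta>: "\<delta> > 0" using L \<epsilon> by (simp add: \<delta>_def)
    have L\<delta>: "L * \<delta> \<le> \<epsilon> / 4"
    proof -
      have "L * \<epsilon> \<le> \<epsilon> * (L + 1)" using \<epsilon> by (simp add: distrib_left)
      hence "L * \<epsilon> / (L + 1) \<le> \<epsilon>" using L by (subst pos_divide_le_eq) auto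
      hence "L * \<epsilon> / (L + 1) / 4 \<le> \<epsilon> / 4" by (rule divide_right_mono) simp
      moreover have "L * \<delta> = L * \<epsilon> / (L + 1) / 4" by (simp add: \<delta>_def)
      ultimately show ?thesis by (simp only:)
    qed
    from input_sequence_approx[OF x zero_less_power[OF \<delta>, of 2]] obtain y where
      y: "standard_sequence M y"
      and xy: "\<And>i. integrable M (\<lambda>\<omega>. (x i \<omega> - y i \<omega>)\<^sup>2)" "\<And>i. expectation (\<lambda>\<omega>. (x i \<omega> - y i \<omega>)\<^sup>2) \<le> \<delta>\<^sup>2"
      by blast
    interpret y: standard_sequence M y by (rule y)
    from y.expectation_spectral_power[OF k, of \<Delta>] obtain K1 where
      K1: "\<And>n. n > 0 \<Longrightarrow> \<bar>expectation (\<lambda>\<omega>. spectral_sum (\<lambda>a. a ^ (2 * k)) (link_matrix (G n) n (\<lambda>i. y i \<omega>)) / real n) - c k n\<bar> \<le> K1 / real n"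
      unfolding c_def using fib by blast
    have "2 * k \<ge> 1" using k by simp
    from y.expectation_spectral_power[OF this, of \<Delta>] obtain K2 where
      K2: "\<And>n. n > 0 \<Longrightarrow> \<bar>expectation (\<lambda>\<omega>. spectral_sum (\<lambda>a. a ^ (2 * (2 * k))) (link_matrix (G n) n (\<lambda>i. y i \<omega>)) / real n) - c (2 * k) n\<bar> \<le> K2 / real n"
      unfolding c_def using fib by blast
    let ?S = "\<lambda>f z n \<omega>. spectral_sum f (link_matrix (G n) n (\<lambda>i. z i \<omega>)) / real n"
    have "(\<lambda>n. expectation (?S (?\<phi> R) x n)) \<longlonglongrightarrow> integral\<^sup>L F (?\<phi> R)"
      by (rule expectation_spectral_sum_limit[OF prob_space_axioms x_meas lsd lip L bdd])
    hence ev1: "eventually (\<lambda>n. \<bar>expectation (?S (?\<phi> R) x n) - integral\<^sup>L F (?\<phi> R)\<bar> < \<epsilon> / 4) sequentially"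
      unfolding dist_real_def[symmetric] using \<epsilon> by (intro tendstoD) simp_all
    have small: "eventually (\<lambda>n. K / real n < \<epsilon>') sequentially" if "\<epsilon>' > 0" for K \<epsilon>'
      using order_tendstoD(2)[OF lim_const_over_n[of K] that] .
    have ev2: "eventually (\<lambda>n. K1 / real n < \<epsilon> / 4) sequentially"
      and ev3: "eventually (\<lambda>n. K2 / real n < \<epsilon> / 4 * R ^ (2 * k)) sequentially"
      using \<epsilon> R by (auto intro!: small)
    from ev1 ev2 ev3 eventually_gt_at_top[of 0] show ?thesis
    proof eventually_elim
      case (elim n)
      note K1' = elim(2) and K2' = elim(3) and n = elim(4)
      have d1: "\<bar>expectation (?S (?\<phi> R) x n) - expectation (?S (?\<phi> R) y n)\<bar> \<le> L * \<delta>"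
        by (rule expectation_spectral_sum_diff[OF x_meas y.measurable_y xy lip L bdd \<delta> n])
      have int\<phi>: "integrable M (?S (?\<phi> R) y n)"
      proof (rule integrable_const_bound[where B = "R ^ (2 * k)"])
        show "?S (?\<phi> R) y n \<in> borel_measurable M"
          using measurable_spectral_sum_link[OF lip L n y.measurable_y] by simp
        show "AE \<omega> in M. norm (?S (?\<phi> R) y n \<omega>) \<le> R ^ (2 * k)"
        proof (rule AE_I2)
          fix \<omega>
          show "norm (?S (?\<phi> R) y n \<omega>) \<le> R ^ (2 * k)"
            using spectral_sum_const_bound[of "?\<phi> R" "R ^ (2 * k)" "G n" n "\<lambda>i. y i \<omega>", OF bdd] n
            by (simp add: field_simps abs_divide)
        qed
      qed
      have intp: "integrable M (?S (\<lambda>a. a ^ (2 * m)) y n)" for m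
        using y.integrable_spectral_power[OF n] by simp
      have d2: "\<bar>expectation (?S (?\<phi> R) y n) - expectation (?S (\<lambda>a. a ^ (2 * k)) y n)\<bar>
          \<le> expectation (?S (\<lambda>a. a ^ (2 * (2 * k))) y n) / R ^ (2 * k)"
      proof -
        have "\<bar>expectation (?S (?\<phi> R) y n) - expectation (?S (\<lambda>a. a ^ (2 * k)) y n)\<bar>
            = \<bar>expectation (\<lambda>\<omega>. ?S (?\<phi> R) y n \<omega> - ?S (\<lambda>a. a ^ (2 * k)) y n \<omega>)\<bar>"
          by (simp only: Bochner_Integration.integral_diff[OF int\<phi> intp])
        also have "\<dots> \<le> expectation (\<lambda>\<omega>. \<bar>?S (?\<phi> R) y n \<omega> - ?S (\<lambda>a. a ^ (2 * k)) y n \<omega>\<bar>)"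
          by (rule integral_abs_bound)
        also have "\<dots> \<le> expectation (\<lambda>\<omega>. ?S (\<lambda>a. a ^ (2 * (2 * k))) y n \<omega> / R ^ (2 * k))"
        proof (rule integral_mono)
          show "integrable M (\<lambda>\<omega>. \<bar>?S (?\<phi> R) y n \<omega> - ?S (\<lambda>a. a ^ (2 * k)) y n \<omega>\<bar>)"
            by (intro integrable_abs Bochner_Integration.integrable_diff int\<phi> intp)
          show "integrable M (\<lambda>\<omega>. ?S (\<lambda>a. a ^ (2 * (2 * k))) y n \<omega> / R ^ (2 * k))"
            by (intro Bochner_Integration.integrable_divide_zero intp)
          fix \<omega>
          let ?A = "link_matrix (G n) n (\<lambda>i. y i \<omega>)"
          have "\<exists>U d. diagonalizes n U d (\<lambda>i j. ?A $$ (i,j)) \<and> proots (char_poly ?A) = image_mset d (mset_set {..<n})"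
            by (intro symmetric_mat_diagonalization link_matrix_sym) auto
          then obtain d where roots: "proots (char_poly ?A) = image_mset d (mset_set {..<n})" by blast
          have "\<bar>?S (?\<phi> R) y n \<omega> - ?S (\<lambda>a. a ^ (2 * k)) y n \<omega>\<bar>
              = \<bar>\<Sum>i<n. ?\<phi> R (d i) - d i ^ (2 * k)\<bar> / real n"
            by (simp only: spectral_sum_eq[OF roots] sum_subtractf diff_divide_distrib[symmetric] abs_divide abs_of_nat)
          also have "\<dots> \<le> (\<Sum>i<n. d i ^ (2 * (2 * k)) / R ^ (2 * k)) / real n"
            by (intro divide_right_mono order.trans[OF sum_abs] sum_mono capped_power_error R) simp
          also have "\<dots> = ?S (\<lambda>a. a ^ (2 * (2 * k))) y n \<omega> / R ^ (2 * k)"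
            by (simp only: spectral_sum_eq[OF roots] sum_divide_distrib[symmetric] divide_divide_eq_left mult.commute)
          finally show "\<bar>?S (?\<phi> R) y n \<omega> - ?S (\<lambda>a. a ^ (2 * k)) y n \<omega>\<bar>
              \<le> ?S (\<lambda>a. a ^ (2 * (2 * k))) y n \<omega> / R ^ (2 * k)" .
        qed
        also have "\<dots> = expectation (?S (\<lambda>a. a ^ (2 * (2 * k))) y n) / R ^ (2 * k)" by simp
        finally show ?thesis .
      qed
      have d3: "expectation (?S (\<lambda>a. a ^ (2 * (2 * k))) y n) / R ^ (2 * k) \<le> C (2 * k) / R ^ (2 * k) + \<epsilon> / 4"
      proof -
        have "expectation (?S (\<lambda>a. a ^ (2 * (2 * k))) y n) \<le> C (2 * k) + \<epsilon> / 4 * R ^ (2 * k)"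
          using K2[OF n] K2' c_le[of "2 * k" n] unfolding abs_le_iff by linarith
        hence "expectation (?S (\<lambda>a. a ^ (2 * (2 * k))) y n) / R ^ (2 * k) \<le> (C (2 * k) + \<epsilon> / 4 * R ^ (2 * k)) / R ^ (2 * k)"
          using R by (intro divide_right_mono) auto
        thus ?thesis using R by (simp add: add_divide_distrib)
      qed
      show ?case
        using elim(1) d1 d2 d3 K1[OF n] K1' L\<delta> unfolding abs_le_iff abs_less_iff by linarith
    qed
  qed
  have \<phi>_int: "integrable F (?\<phi> (real N))" for N
  proof (rule F.integrable_const_bound[where B = "real N ^ (2 * k)"])
    show "AE t in F. norm (?\<phi> (real N) t) \<le> real N ^ (2 * k)" using capped_power_bound by simp
    show "?\<phi> (real N) \<in> borel_measurable F" unfolding capped_power_def by simp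
  qed
  have \<phi>_mono: "?\<phi> (real N) t \<le> ?\<phi> (real N') t" if "N \<le> N'" for N N' t
    unfolding capped_power_def using that by (intro power_mono) auto
  have inc: "incseq (\<lambda>N. integral\<^sup>L F (?\<phi> (real N)))"
    using \<phi>_int \<phi>_mono by (intro monoI integral_mono)
  have upper: "integral\<^sup>L F (?\<phi> (real N)) \<le> C k + C (2 * k) + 1" for N
  proof -
    \<comment> \<open>The passage to \<open>Suc N\<close> makes the cap positive, as
      \<open>approx\<close> requires, and at least 1, so that the tail term is at most
      \<open>C (2 * k)\<close>.\<close>
    have "integral\<^sup>L F (?\<phi> (real N)) \<le> integral\<^sup>L F (?\<phi> (real (Suc N)))" by (rule incseq_SucD[OF inc])
    also have "\<dots> \<le> C k + C (2 * k) + 1"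
    proof -
      have "eventually (\<lambda>n. \<bar>integral\<^sup>L F (?\<phi> (real (Suc N))) - c k n\<bar> \<le> C (2 * k) / real (Suc N) ^ (2 * k) + 1) sequentially"
        by (rule approx) auto
      then obtain n where n: "\<bar>integral\<^sup>L F (?\<phi> (real (Suc N))) - c k n\<bar> \<le> C (2 * k) / real (Suc N) ^ (2 * k) + 1"
        using eventually_happens'[OF sequentially_bot] by blast
      have "C (2 * k) / real (Suc N) ^ (2 * k) \<le> C (2 * k) / 1"
        by (intro divide_left_mono one_le_power) (auto simp: C_def)
      thus ?thesis using n c_le[of k n] unfolding abs_le_iff by simp
    qed
    finally show ?thesis .
  qed
  have lim: "(\<lambda>N. integral\<^sup>L F (?\<phi> (real N))) \<longlonglongrightarrow> moment F (2 * k)"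
  proof -
    obtain l where l: "(\<lambda>N. integral\<^sup>L F (?\<phi> (real N))) \<longlonglongrightarrow> l"
      using incseq_convergent[OF inc] upper by blast
    \<comment> \<open>Monotone convergence supplies integrability along with the value, so the
      moment is not the default value 0 of a divergent integral.\<close>
    have "integral\<^sup>L F (\<lambda>t. t ^ (2 * k)) = l"
    proof (rule integral_monotone_convergence[OF \<phi>_int _ _ l])
      show "AE t in F. mono (\<lambda>N. ?\<phi> (real N) t)" using \<phi>_mono by (intro AE_I2 monoI)
      show "AE t in F. (\<lambda>N. ?\<phi> (real N) t) \<longlonglongrightarrow> t ^ (2 * k)"
      proof (rule AE_I2, rule tendsto_eventually)
        fix t
        have "eventually (\<lambda>N. \<bar>t\<bar> \<le> real N) sequentially"
          using filterlim_real_sequentially by (auto simp: filterlim_at_top)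
        thus "eventually (\<lambda>N. ?\<phi> (real N) t = t ^ (2 * k)) sequentially"
          by eventually_elim (simp add: capped_power_def power_mult)
      qed
    qed simp
    with l show ?thesis by (simp add: moment_def)
  qed
  have tail: "(\<lambda>N. C (2 * k) / real N ^ (2 * k)) \<longlonglongrightarrow> 0"
    using k by (intro tendsto_divide_0[OF tendsto_const] filterlim_at_top_imp_at_infinity
        filterlim_pow_at_top filterlim_real_sequentially) auto
  have "c k \<longlonglongrightarrow> moment F (2 * k)"
  proof (rule tendstoI)
    fix e :: real assume e: "e > 0"
    have "eventually (\<lambda>N. C (2 * k) / real N ^ (2 * k) < e / 3) sequentially"
      using e by (intro order_tendstoD(2)[OF tail]) simp
    moreover have "eventually (\<lambda>N. \<bar>integral\<^sup>L F (?\<phi> (real N)) - moment F (2 * k)\<bar> < e / 3) sequentially"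
      unfolding dist_real_def[symmetric] using e by (intro tendstoD[OF lim]) simp
    ultimately have "eventually (\<lambda>N. N > 0 \<and> C (2 * k) / real N ^ (2 * k) < e / 3 \<and>
        \<bar>integral\<^sup>L F (?\<phi> (real N)) - moment F (2 * k)\<bar> < e / 3) sequentially"
      using eventually_gt_at_top[of 0] by eventually_elim simp
    then obtain N where N: "N > 0" "C (2 * k) / real N ^ (2 * k) < e / 3"
      "\<bar>integral\<^sup>L F (?\<phi> (real N)) - moment F (2 * k)\<bar> < e / 3"
      using eventually_happens'[OF sequentially_bot] by blast
    \<comment> \<open>The cap \<open>N\<close> is now fixed, and only then does \<open>n\<close>
      grow; each of the three errors is at most \<open>e / 3\<close>.\<close>
    have "eventually (\<lambda>n. \<bar>integral\<^sup>L F (?\<phi> (real N)) - c k n\<bar> \<le> C (2 * k) / real N ^ (2 * k) + e / 3) sequentially"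
      using N e by (intro approx) auto
    thus "eventually (\<lambda>n. dist (c k n) (moment F (2 * k)) < e) sequentially"
    proof eventually_elim
      case (elim n)
      thus ?case using N(2,3) unfolding dist_real_def abs_le_iff abs_less_iff by linarith
    qed
  qed
  thus ?thesis by (simp only: c_def)
qed

section \<open>Fibre bounds for the two links, and the comparison of their moments\<close>

lemma fibre_bound_id: "\<Delta> \<ge> 1 \<Longrightarrow> fibre_bound \<Delta> (\<lambda>s. s) n"
proof -
  assume \<Delta>: "\<Delta> \<ge> 1"
  have "card {j. j < n \<and> Suc j + Suc i = a} \<le> 1" for i a
    by (rule card_le_Suc0_iff_eq[THEN iffD2, folded One_nat_def]) auto
  thus ?thesis unfolding fibre_bound_def using \<Delta> order.trans by blast
qed

text \<open>All such \<open>j\<close> lie in one residue class modulo \<open>m\<close>, so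
  \<open>j\<close> is determined by \<open>j div m\<close>, which takes at most
  \<open>n div m + 1\<close> values.\<close>

lemma card_residue_class:
  assumes m: "m > (0 :: nat)"
  shows "card {j. j < n \<and> (Suc j + Suc i) mod m = a} \<le> n div m + 1"
proof -
  let ?J = "{j. j < n \<and> (Suc j + Suc i) mod m = a}"
  have inj: "inj_on (\<lambda>j. j div m) ?J"
  proof (rule inj_onI)
    fix j j' assume j: "j \<in> ?J" "j' \<in> ?J" and eq: "j div m = j' div m"
    have same: "j mod m = j' mod m" if "j \<le> j'" "j \<in> ?J" "j' \<in> ?J" for j j'
    proof -
      have "(Suc j' + Suc i) mod m = (Suc j + Suc i) mod m" using that by simp
      hence "m dvd (Suc j' + Suc i) - (Suc j + Suc i)" using that by (subst (asm) mod_eq_dvd_iff_nat) auto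
      thus ?thesis using that mod_eq_dvd_iff_nat[of j j' m] by simp
    qed
    have "j mod m = j' mod m"
    proof (cases "j \<le> j'")
      case True
      thus ?thesis using j by (rule same)
    next
      case False
      hence "j' mod m = j mod m" using j by (intro same) simp_all
      thus ?thesis by simp
    qed
    with eq show "j = j'" by (metis div_mult_mod_eq)
  qed
  have "card ?J = card ((\<lambda>j. j div m) ` ?J)" by (rule card_image[OF inj, symmetric])
  also have "\<dots> \<le> card {..n div m}" by (intro card_mono) (auto intro: div_le_mono)
  finally show ?thesis by simp
qed

text \<open>For a modulus \<open>m \<ge> 1\<close>, \<open>n / \<theta> < m + 1 \<le> 2 * m\<close>
  gives \<open>n / m < 2 * \<theta>\<close>, a bound independent of \<open>n\<close>. For the
  finitely many \<open>n\<close> with modulus 0, \<open>s mod 0 = s\<close> makes the link the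
  identity.\<close>

lemma fibre_bound_link:
  assumes \<theta>: "\<theta> > 0"
  shows "fibre_bound (nat \<lceil>2 * \<theta>\<rceil> + 1) (\<lambda>s. s mod nat \<lfloor>real n / \<theta>\<rfloor>) n"
proof (cases "nat \<lfloor>real n / \<theta>\<rfloor> = 0")
  case True
  show ?thesis unfolding True using fibre_bound_id[of "nat \<lceil>2 * \<theta>\<rceil> + 1" n] by simp
next
  case False
  define m where "m = nat \<lfloor>real n / \<theta>\<rfloor>"
  have m: "m \<ge> 1" using False unfolding m_def by linarith
  have "real n / \<theta> < real m + 1" unfolding m_def by linarith
  hence "real n / \<theta> < 2 * real m" using m by simp
  hence "real n < 2 * \<theta> * real m" using \<theta> by (simp add: pos_divide_less_eq mult_ac)
  hence "real n / real m < 2 * \<theta>" using m by (simp add: pos_divide_less_eq)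
  hence "real (n div m) < 2 * \<theta>" using of_nat_div_le_of_nat[of n m, where ?'a = real] by linarith
  hence "n div m \<le> nat \<lceil>2 * \<theta>\<rceil>" by linarith
  hence bound: "n div m + 1 \<le> nat \<lceil>2 * \<theta>\<rceil> + 1" by simp
  have "m > 0" using m by simp
  from order.trans[OF card_residue_class[OF this] bound] show ?thesis
    unfolding fibre_bound_def m_def[symmetric] by blast
qed

theorem corollary3p1:
  fixes M :: "'a measure" and x :: "nat \<Rightarrow> 'a \<Rightarrow> real"
    and F :: "real \<Rightarrow> real measure" and F_Hankel :: "real measure"
  assumes "input_sequence M x"
    and "\<And>\<theta>. \<theta> > 0 \<Longrightarrow> is_lsd M (theta_matrix x \<theta>) (F \<theta>)"
    and "is_lsd M (hankel_matrix x) F_Hankel"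
  shows "\<forall>\<theta>>0. \<forall>k\<ge>1. moment (F \<theta>) (2 * k) \<ge> moment (F (1/2)) (2 * k)
                   \<and> moment (F (1/2)) (2 * k) = moment F_Hankel (2 * k)"
proof (intro allI impI)
  fix \<theta> :: real and k :: nat assume \<theta>: "\<theta> > 0" and k: "1 \<le> k"
  define G where "G = (\<lambda>\<theta> n s. s mod nat \<lfloor>real n / \<theta>\<rfloor>)"
  have lim: "(\<lambda>n. real (card (even_walks (G \<theta> n) n (2 * k))) / real n ^ Suc k) \<longlonglongrightarrow> moment (F \<theta>) (2 * k)"
    if "\<theta> > 0" for \<theta>
  proof (rule moment_lsd_link[OF assms(1) _ _ k])
    show "fibre_bound (nat \<lceil>2 * \<theta>\<rceil> + 1) (G \<theta> n) n" for n unfolding G_def by (rule fibre_bound_link[OF that])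
    have "theta_matrix x \<theta> = (\<lambda>n \<omega>. link_matrix (G \<theta> n) n (\<lambda>i. x i \<omega>))"
      unfolding theta_matrix_def link_matrix_def link_def G_def by (rule refl)
    thus "is_lsd M (\<lambda>n \<omega>. link_matrix (G \<theta> n) n (\<lambda>i. x i \<omega>)) (F \<theta>)" using assms(2)[OF that] by simp
  qed
  have lim_Hankel: "(\<lambda>n. real (card (even_walks (\<lambda>s. s) n (2 * k))) / real n ^ Suc k) \<longlonglongrightarrow> moment F_Hankel (2 * k)"
  proof (rule moment_lsd_link[OF assms(1) _ _ k])
    show "fibre_bound 1 (\<lambda>s. s) n" for n by (rule fibre_bound_id) simp
    have "hankel_matrix x = (\<lambda>n \<omega>. link_matrix (\<lambda>s. s) n (\<lambda>i. x i \<omega>))"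
      unfolding hankel_matrix_def link_matrix_def by (rule refl)
    thus "is_lsd M (\<lambda>n \<omega>. link_matrix (\<lambda>s. s) n (\<lambda>i. x i \<omega>)) F_Hankel" using assms(3) by simp
  qed
  have half: "even_walks (G (1/2) n) n (2 * k) = even_walks (\<lambda>s. s) n (2 * k)" for n
  proof (rule even_walks_inj, rule inj_onI)
    fix s t assume st: "s \<in> {2..2 * n}" "t \<in> {2..2 * n}" and eq: "G (1/2) n s = G (1/2) n t"
    have "real n / (1/2) = real (2 * n)" by simp
    hence "nat \<lfloor>real n / (1/2)\<rfloor> = 2 * n" by (simp only: floor_of_nat nat_int)
    hence "s mod (2 * n) = t mod (2 * n)" using eq by (simp only: G_def)
    \<comment> \<open>Reduction modulo \<open>2 * n\<close> fixes every element of
      \<open>{2..2 * n}\<close> except \<open>2 * n\<close>, which goes to 0, a value taken by no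
      other element.\<close>
    thus "s = t" using st by (cases "s = 2 * n"; cases "t = 2 * n") auto
  qed
  have eq: "moment (F (1/2)) (2 * k) = moment F_Hankel (2 * k)"
    using lim[of "1/2"] lim_Hankel unfolding half by (intro LIMSEQ_unique) auto
  have "moment F_Hankel (2 * k) \<le> moment (F \<theta>) (2 * k)"
  \<comment> \<open>The inclusion of walk sets holds for every \<open>n\<close>, so the inequality
    passes to the limit directly.\<close>
  proof (rule LIMSEQ_le[OF lim_Hankel lim[OF \<theta>]], intro exI allI impI divide_right_mono of_nat_mono card_mono)
    show "even_walks (\<lambda>s. s) n (2 * k) \<subseteq> even_walks (G \<theta> n) n (2 * k)" for n
      by (rule even_walks_comp_mono)
    show "finite (even_walks (G \<theta> n) n (2 * k))" for n
      unfolding even_walks_def by simp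
  qed simp
  with eq show "moment (F \<theta>) (2 * k) \<ge> moment (F (1/2)) (2 * k) \<and> moment (F (1/2)) (2 * k) = moment F_Hankel (2 * k)"
    by simp
qed

end
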